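(* Consider $T$ rounds of stochastic online generalized linear regression in $\mathbb{R}^d$ (as defined in the context), with $\|x_t\|_2\le A$ for all $t\in[T]$, $\|\mu^*\|_2\le B$, and activation function $\phi$ satisfying $0<\kappa\le\phi'(z)\le K$ for all $z\in[-B,B]$. Suppose the noise $\epsilon_1,\dots,\epsilon_T$ is a sequence of i.i.d. zero-mean $\sigma$-sub-Gaussian random variables, i.e. $\mathbb{E}[\exp(s\epsilon_t)]\le\exp(\sigma^2s^2/2)$ for all $s\in\mathbb{R}$ and all $t$. Let $\hat\mu_1,\dots,\hat\mu_T$ be the iterates of the follow-the-regularized-leader algorithm (FTRL) with $\lambda=4A^2K^2/\kappa$. Then for every $\delta\in(0,1/2)$, with probability at least $1-2\delta$, $$\mathcal{R}^{\mathrm{stoc}}(T)\le \frac{34}{\kappa}\,\sigma^2 d\log\frac{4dK^2+T\kappa^2}{4dK^2}+\frac{8K^2A^2B^2}{\kappa}+2\left(\frac{2}{\kappa}+\frac{3\kappa}{K^2}\right)\sigma^2\log(1/\delta).$$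
   Context: Stochastic online generalized linear regression: $\phi:\mathbb{R}\to\mathbb{R}$ is a known activation function which is increasing and differentiable on $[-B,B]$, with constants $\kappa,K\in\mathbb{R}$ such that $0<\kappa\le\phi'(z)\le K$ for all $z\in[-B,B]$. There is an unknown $\mu^*\in\mathbb{R}^d$ with $\|\mu^*\|_2\le B$. At each round $t\in[T]=\{1,\dots,T\}$, the learner observes a feature vector $x_t\in\mathbb{R}^d$, $\|x_t\|_2\le A$, generated arbitrarily by the environment; it outputs a prediction $\hat y_t=\phi(\langle\hat\mu_t,x_t\rangle)$, where $\hat\mu_t$ is its estimate of $\mu^*$; then the label $y_t=\phi(\langle\mu^*,x_t\rangle)+\epsilon_t$, with $\epsilon_t$ a stochastic noise, is revealed. Loss: $\ell_t(\mu):=-x_t^\top\mu\,y_t+\int_0^{x_t^\top\mu}\phi(z)\,dz$. Stochastic regret: $\mathcal{R}^{\mathrm{stoc}}(T):=\sum_{t=1}^T\ell_t(\hat\mu_t)-\sum_{t=1}^T\ell_t(\mu^* )$. FTRL with parameter $\lambda>0$: $\hat\mu_1=0$ and $\hat\mu_{t+1}=\operatorname{argmin}_{\mu\in\mathbb{R}^d}\big(\lambda\|\mu\|_2^2+\sum_{\tau=1}^t\ell_\tau(\mu)\big)$ for $t\ge1$.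
   Formalization: The bounds κ ≤ φ' ≤ K are assumed on an interval I containing [-B,B] (possibly all of ℝ), and ⟨μ*,x_t⟩ and ⟨μ̂_t,x_τ⟩ (τ ≤ t) are assumed to lie in I; with bounds only on [-B,B] and unconstrained FTRL the claim is false. *)

theory Defs
  imports "HOL-Probability.Probability"
begin

text \<open>
  Rounds are numbered from 1, as in \<open>[T] = {1..T}\<close>. The interval integral is the oriented
  Lebesgue integral, so it also covers a negative upper limit \<open>x \<bullet> \<mu>\<close>.
\<close>

definition glr_loss ::
  "(real \<Rightarrow> real) \<Rightarrow> real ^ 'd \<Rightarrow> real \<Rightarrow> real ^ 'd \<Rightarrow> real" where
  "glr_loss \<phi> x y \<mu> = - (x \<bullet> \<mu>) * y + (LBINT z=0..x \<bullet> \<mu>. \<phi> z)"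

definition glr_label ::
  "(real \<Rightarrow> real) \<Rightarrow> real ^ 'd \<Rightarrow> (nat \<Rightarrow> real ^ 'd) \<Rightarrow> (nat \<Rightarrow> real) \<Rightarrow> nat \<Rightarrow> real" where
  "glr_label \<phi> \<mu>s x \<epsilon> t = \<phi> (\<mu>s \<bullet> x t) + \<epsilon> t"

definition stoc_regret ::
  "(real \<Rightarrow> real) \<Rightarrow> (nat \<Rightarrow> real ^ 'd) \<Rightarrow> (nat \<Rightarrow> real) \<Rightarrow> real ^ 'd
    \<Rightarrow> (nat \<Rightarrow> real ^ 'd) \<Rightarrow> nat \<Rightarrow> real" where
  "stoc_regret \<phi> x y \<mu>s \<mu>h T =
     (\<Sum>t=1..T. glr_loss \<phi> (x t) (y t) (\<mu>h t)) - (\<Sum>t=1..T. glr_loss \<phi> (x t) (y t) \<mu>s)"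

definition ftrl_iterates ::
  "real \<Rightarrow> (real \<Rightarrow> real) \<Rightarrow> (nat \<Rightarrow> real ^ 'd) \<Rightarrow> (nat \<Rightarrow> real) \<Rightarrow> nat
    \<Rightarrow> (nat \<Rightarrow> real ^ 'd) \<Rightarrow> bool" where
  "ftrl_iterates lam \<phi> x y T \<mu>h \<longleftrightarrow>
     \<mu>h 1 = 0 \<and>
     (\<forall>t. 1 \<le> t \<and> t < T \<longrightarrow>
        is_arg_min (\<lambda>\<mu>. lam * (norm \<mu>)\<^sup>2 + (\<Sum>\<tau>=1..t. glr_loss \<phi> (x \<tau>) (y \<tau>) \<mu>))
          (\<lambda>\<mu>. True) (\<mu>h (Suc t)))"

text \<open>
  Integrability is stated because the Bochner integral of a non-integrable function is 0,
  which would make the bound on the moment generating function hold vacuously.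
\<close>

definition subgaussian :: "'w measure \<Rightarrow> real \<Rightarrow> ('w \<Rightarrow> real) \<Rightarrow> bool" where
  "subgaussian M \<sigma> X \<longleftrightarrow>
     (\<forall>s. integrable M (\<lambda>\<omega>. exp (s * X \<omega>)) \<and>
          (\<integral>\<omega>. exp (s * X \<omega>) \<partial>M) \<le> exp (\<sigma>\<^sup>2 * s\<^sup>2 / 2))"

text \<open>
  The features may be chosen adaptively. \<open>F t\<close> is the information available once round
  \<open>t\<close> is over: it contains the noise up to round \<open>t\<close> and whatever randomness the
  environment uses. The feature \<open>x t\<close> is fixed by \<open>F (t - 1)\<close>, before the noise of
  round \<open>t\<close> is drawn, and that noise is independent of \<open>F (t - 1)\<close>.
  Features fixed in advance are the special case in which \<open>F t\<close> is generated by
  \<open>\<epsilon> 1, \<dots>, \<epsilon> t\<close>.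
\<close>

definition online_protocol ::
  "'w measure \<Rightarrow> (nat \<Rightarrow> 'w measure) \<Rightarrow> nat \<Rightarrow> (nat \<Rightarrow> 'w \<Rightarrow> real ^ 'd)
    \<Rightarrow> (nat \<Rightarrow> 'w \<Rightarrow> real) \<Rightarrow> bool" where
  "online_protocol M F T x \<epsilon> \<longleftrightarrow>
     filtration (space M) F \<and> (\<forall>t. subalgebra M (F t)) \<and>
     (\<forall>t\<in>{1..T}. x t \<in> borel_measurable (F (t - 1)) \<and>
        \<epsilon> t \<in> borel_measurable (F t) \<and>
        prob_space.indep_set M (sets (F (t - 1)))
          (sets (vimage_algebra (space M) (\<epsilon> t) borel)))"

definition iid_noise :: "'w measure \<Rightarrow> nat \<Rightarrow> (nat \<Rightarrow> 'w \<Rightarrow> real) \<Rightarrow> bool" where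
  "iid_noise M T \<epsilon> \<longleftrightarrow>
     prob_space.indep_vars M (\<lambda>_. borel) \<epsilon> {1..T} \<and>
     (\<forall>s\<in>{1..T}. \<forall>t\<in>{1..T}. distr M borel (\<epsilon> s) = distr M borel (\<epsilon> t))"

text \<open>
  The activation is controlled on an interval \<open>I\<close> containing \<open>[-B, B]\<close>; at an end point
  belonging to \<open>I\<close> the derivative is one-sided. Monotonicity of \<open>\<phi>\<close> on \<open>I\<close> follows
  from \<open>0 < \<kappa>\<close>.
\<close>

definition activation ::
  "(real \<Rightarrow> real) \<Rightarrow> real set \<Rightarrow> real \<Rightarrow> real \<Rightarrow> real \<Rightarrow> bool" where
  "activation \<phi> I B \<kappa> K \<longleftrightarrow>
     is_interval I \<and> {-B..B} \<subseteq> I \<and> 0 < \<kappa> \<and>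
     (\<exists>\<phi>'. \<forall>z\<in>I. (\<phi> has_real_derivative \<phi>' z) (at z within I) \<and> \<kappa> \<le> \<phi>' z \<and> \<phi>' z \<le> K)"

text \<open>
  FTRL minimises over the whole space, so nothing else confines the arguments of \<open>\<phi>\<close> to the
  interval on which \<open>\<phi>\<close> is controlled. The condition asks this of the true parameter, and of
  each iterate on the features observed up to its round. It always holds if
  \<open>I = UNIV\<close>, that is, if the derivative bounds are global.
\<close>

definition args_within ::
  "real set \<Rightarrow> (nat \<Rightarrow> real ^ 'd) \<Rightarrow> real ^ 'd \<Rightarrow> (nat \<Rightarrow> real ^ 'd) \<Rightarrow> nat \<Rightarrow> bool" where
  "args_within I x \<mu>s \<mu>h T \<longleftrightarrow>
     (\<forall>t\<in>{1..T}. \<mu>s \<bullet> x t \<in> I \<and> (\<forall>\<tau>\<in>{1..t}. \<mu>h t \<bullet> x \<tau> \<in> I))"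

end

theory Submission
  imports Defs
begin

text \<open>
  Write \<open>a\<^sub>t = x\<^sub>t \<bullet> (\<mu>h\<^sub>t - \<mu>s)\<close>, \<open>G\<^sub>t = 2 lam I + \<kappa> (x\<^sub>1 x\<^sub>1\<^sup>T + \<dots> + x\<^sub>t x\<^sub>t\<^sup>T)\<close> and
  \<open>w\<^sub>t = x\<^sub>t\<^sup>T G\<^sub>t\<^sup>-\<^sup>1 x\<^sub>t\<close>. Strong convexity of the FTRL objective in the norm of \<open>G\<^sub>t\<close> gives
  \<open>regret \<le> lam B\<^sup>2 + \<kappa>/8 \<Sum> a\<^sub>t\<^sup>2 + \<Sum> \<epsilon>\<^sub>t\<^sup>2 w\<^sub>t\<close>, because the choice of \<open>lam\<close> forces
  \<open>w\<^sub>t \<le> \<kappa>/(8K\<^sup>2)\<close>. Conversely \<open>regret \<ge> \<kappa>/2 \<Sum> a\<^sub>t\<^sup>2 - \<Sum> a\<^sub>t \<epsilon>\<^sub>t\<close>, and an exponential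
  supermartingale bounds the last sum by \<open>\<kappa>/8 \<Sum> a\<^sub>t\<^sup>2 + 4\<sigma>\<^sup>2/\<kappa> ln (1/\<delta>)\<close>. Hence \<open>\<Sum> a\<^sub>t\<^sup>2\<close> can be
  eliminated between the two bounds. A second supermartingale replaces \<open>\<epsilon>\<^sub>t\<^sup>2\<close> by
  \<open>2\<sigma>\<^sup>2\<close> in \<open>\<Sum> \<epsilon>\<^sub>t\<^sup>2 w\<^sub>t\<close>, and \<open>\<kappa> w\<^sub>t \<le> ln det G\<^sub>t - ln det G\<^sub>t\<^sub>-\<^sub>1\<close> telescopes.
\<close>

section \<open>Activation and loss\<close>

text \<open>The tail bounds need \<open>gap t\<close> to be known at \<open>F (t - 1)\<close>, yet
  the iterates are given only as pointwise minimisers and nothing is assumed about their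
  measurability. Strong convexity makes the minimiser unique among admissible points, so it can be
  recovered as a limit of measurable approximate minimisers. A second obstacle is that
  \<open>\<phi>\<close> is controlled only on \<open>I\<close>, an arbitrary interval, while the
  minimisation runs over the whole space. Convexity is therefore used only along segments whose
  arguments stay in \<open>I\<close>, and a minimiser never has to satisfy a stationarity equation.
  The matrix of round \<open>t\<close> contains the feature of round \<open>t\<close> itself: the
  curvature of the current loss supplies that term, and the feature is already fixed by
  \<open>F (t - 1)\<close>, so the widths stay predictable. With S the sum of squared gaps, U the
  upper bound without its gap term and E the deviation of the noise sum, 3\<kappa>/8 S \<le> regret
  + E and regret \<le> U + \<kappa>/8 S combine to regret \<le> 3/2 U + 1/2 E. The two exceptional
  events account for 2\<delta>.\<close>

lemma mvt_within:
  fixes g g' :: "real \<Rightarrow> real"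
  assumes "a \<le> b" and sub: "{a..b} \<subseteq> S"
    and der: "\<And>z. z \<in> S \<Longrightarrow> (g has_real_derivative g' z) (at z within S)"
  obtains z where "z \<in> {a..b}" "g b - g a = g' z * (b - a)"
proof (cases "a = b")
  case False
  have "(g has_real_derivative g' z) (at z within {a..b})" if "z \<in> {a..b}" for z
    using der sub that by (blast intro: DERIV_subset)
  then have "\<exists>z\<in>{a<..<b}. g b - g a = (\<lambda>h. g' z * h) (b - a)"
    using assms(1) False by (intro mvt_simple) (auto simp: has_field_derivative_def)
  then obtain z where "z \<in> {a<..<b}" "g b - g a = g' z * (b - a)" by auto
  then show ?thesis using that[of z] by auto
qed (use that in auto)

lemma activation_interval: "activation \<phi> I B \<kappa> K \<Longrightarrow> is_interval I"
  and activation_pos: "activation \<phi> I B \<kappa> K \<Longrightarrow> 0 < \<kappa>"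
  by (auto simp: activation_def)

lemma activation_zero: "activation \<phi> I B \<kappa> K \<Longrightarrow> 0 \<le> B \<Longrightarrow> 0 \<in> I"
  by (auto simp: activation_def)

lemma activation_slope_le: "activation \<phi> I B \<kappa> K \<Longrightarrow> 0 \<in> I \<Longrightarrow> \<kappa> \<le> K"
  unfolding activation_def by force

lemma is_interval_segment:
  fixes I :: "real set"
  assumes "is_interval I" "u \<in> I" "v \<in> I"
  shows "{u..v} \<subseteq> I"
  using assms by (meson atLeastAtMost_iff mem_is_interval_1_I subsetI)

lemma activation_continuous: "activation \<phi> I B \<kappa> K \<Longrightarrow> continuous_on I \<phi>"
  unfolding activation_def continuous_on_eq_continuous_within
  by (meson DERIV_continuous)

lemma activation_increment:
  assumes act: "activation \<phi> I B \<kappa> K" and uv: "u \<in> I" "v \<in> I" "u \<le> v"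
  shows "\<kappa> * (v - u) \<le> \<phi> v - \<phi> u" and "\<phi> v - \<phi> u \<le> K * (v - u)"
proof -
  have sub: "{u..v} \<subseteq> I" using act uv activation_interval is_interval_segment by blast
  obtain \<phi>' where d: "\<And>z. z \<in> I \<Longrightarrow> (\<phi> has_real_derivative \<phi>' z) (at z within I)"
    "\<And>z. z \<in> I \<Longrightarrow> \<kappa> \<le> \<phi>' z \<and> \<phi>' z \<le> K"
    using act unfolding activation_def by blast
  obtain z where "z \<in> {u..v}" "\<phi> v - \<phi> u = \<phi>' z * (v - u)"
    using mvt_within[OF uv(3) sub d(1)] by blast
  then show "\<kappa> * (v - u) \<le> \<phi> v - \<phi> u" and "\<phi> v - \<phi> u \<le> K * (v - u)"
    using d(2)[of z] sub uv(3) by (auto intro!: mult_right_mono)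
qed

lemma activation_lipschitz:
  assumes "activation \<phi> I B \<kappa> K" "u \<in> I" "v \<in> I"
  shows "\<bar>\<phi> u - \<phi> v\<bar> \<le> K * \<bar>u - v\<bar>"
  using activation_increment[OF assms(1)] assms(2,3) activation_pos[OF assms(1)]
  by (cases "u \<le> v") (smt (verit) mult_nonneg_nonneg)+

text \<open>The log-partition function of the generalised linear model. A loss is this potential at
  the score minus a linear term, so all its curvature sits here.\<close>

definition antideriv :: "(real \<Rightarrow> real) \<Rightarrow> real \<Rightarrow> real" where
  "antideriv f v = (LBINT z=0..v. f z)"

lemma antideriv_has_derivative:
  assumes "continuous_on {a..b} f" "0 \<in> {a..b}" "v \<in> {a..b}"
  shows "(antideriv f has_real_derivative f v) (at v within {a..b})"
  using interval_integral_FTC2[of a 0 b f v] assms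
  by (simp add: antideriv_def[abs_def] has_real_derivative_iff_has_vector_derivative zero_ereal_def)

text \<open>Removing the linear and quadratic terms leaves \<open>g\<close>, whose derivative
  \<open>\<phi> w - \<phi> u - \<kappa> * (w - u)\<close> has the sign of \<open>w - u\<close> by
  the slope bound; hence \<open>g\<close> is smallest at \<open>u\<close>.\<close>

lemma antideriv_bregman:
  assumes act: "activation \<phi> I B \<kappa> K" and mem: "0 \<in> I" "u \<in> I" "v \<in> I"
  shows "\<phi> u * (v - u) + \<kappa> / 2 * (v - u)\<^sup>2 \<le> antideriv \<phi> v - antideriv \<phi> u"
proof -
  \<comment> \<open>The hull of 0, \<open>u\<close> and \<open>v\<close>: a compact part of
    \<open>I\<close> containing the base point of the integral, as the fundamental theorem
    requires.\<close>
  define a where "a = min 0 (min u v)"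
  define b where "b = max 0 (max u v)"
  have ab: "{a..b} \<subseteq> I"
    using mem act activation_interval
    by (intro is_interval_segment) (auto simp: a_def b_def min_def max_def)
  have uv: "u \<in> {a..b}" "v \<in> {a..b}" "0 \<in> {a..b}" by (auto simp: a_def b_def)
  have cont: "continuous_on {a..b} \<phi>"
    using activation_continuous[OF act] ab continuous_on_subset by blast
  define g where "g w = antideriv \<phi> w - \<phi> u * w - \<kappa> / 2 * (w - u)\<^sup>2" for w
  have g: "(g has_real_derivative \<phi> w - \<phi> u - \<kappa> * (w - u)) (at w within {a..b})" if "w \<in> {a..b}" for w
    unfolding g_def
    by (rule derivative_eq_intros antideriv_has_derivative[OF cont uv(3) that] refl | simp)+
  have "g u \<le> g v"
  proof (cases "u \<le> v")
    case True
    have "{u..v} \<subseteq> {a..b}" using uv by auto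
    then obtain w where w: "w \<in> {u..v}" "g v - g u = (\<phi> w - \<phi> u - \<kappa> * (w - u)) * (v - u)"
      using g True by (rule_tac mvt_within[of u v "{a..b}" g "\<lambda>w. \<phi> w - \<phi> u - \<kappa> * (w - u)"]) auto
    have "w \<in> I" using w(1) \<open>{u..v} \<subseteq> {a..b}\<close> ab by blast
    then have "0 \<le> \<phi> w - \<phi> u - \<kappa> * (w - u)"
      using activation_increment(1)[OF act, of u w] mem w(1) by auto
    then have "0 \<le> g v - g u" unfolding w(2) using True by (intro mult_nonneg_nonneg) auto
    then show ?thesis by simp
  next
    case False
    have "{v..u} \<subseteq> {a..b}" using uv by auto
    then obtain w where w: "w \<in> {v..u}" "g u - g v = (\<phi> w - \<phi> u - \<kappa> * (w - u)) * (u - v)"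
      using g False by (rule_tac mvt_within[of v u "{a..b}" g "\<lambda>w. \<phi> w - \<phi> u - \<kappa> * (w - u)"]) auto
    have "w \<in> I" using w(1) \<open>{v..u} \<subseteq> {a..b}\<close> ab by blast
    then have "\<phi> w - \<phi> u - \<kappa> * (w - u) \<le> 0"
      using activation_increment(1)[OF act, of w u] mem w(1) by (auto simp: algebra_simps)
    then have "g u - g v \<le> 0" unfolding w(2) using False by (intro mult_nonpos_nonneg) auto
    then show ?thesis by simp
  qed
  then show ?thesis by (simp add: g_def algebra_simps)
qed

text \<open>Weight the Bregman inequalities from the intermediate point to both ends by
  \<open>1 - s\<close> and \<open>s\<close>. The linear terms cancel, and the quadratic ones add up
  through \<open>(1 - s) * s\<^sup>2 + s * (1 - s)\<^sup>2 = s * (1 - s)\<close>.\<close>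

lemma antideriv_strongly_convex:
  assumes act: "activation \<phi> I B \<kappa> K" and mem: "0 \<in> I" "u \<in> I" "v \<in> I" and s: "0 \<le> s" "s \<le> 1"
  shows "antideriv \<phi> (u + s * (v - u)) \<le>
    (1 - s) * antideriv \<phi> u + s * antideriv \<phi> v - s * (1 - s) * (\<kappa> / 2 * (v - u)\<^sup>2)"
proof -
  define p where "p = u + s * (v - u)"
  have "p = (1 - s) * u + s * v" by (simp add: p_def algebra_simps)
  then have p: "p \<in> I"
    using convexD[OF is_interval_convex[OF activation_interval[OF act]] mem(2,3), of "1 - s" s] s by simp
  have "\<phi> p * (u - p) + \<kappa> / 2 * (u - p)\<^sup>2 \<le> antideriv \<phi> u - antideriv \<phi> p"
    "\<phi> p * (v - p) + \<kappa> / 2 * (v - p)\<^sup>2 \<le> antideriv \<phi> v - antideriv \<phi> p"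
    using antideriv_bregman[OF act] mem p by auto
  then have "(1 - s) * (\<phi> p * (u - p) + \<kappa> / 2 * (u - p)\<^sup>2) + s * (\<phi> p * (v - p) + \<kappa> / 2 * (v - p)\<^sup>2)
      \<le> (1 - s) * (antideriv \<phi> u - antideriv \<phi> p) + s * (antideriv \<phi> v - antideriv \<phi> p)"
    using s by (intro add_mono mult_left_mono) auto
  moreover have d: "u - p = - s * (v - u)" "v - p = (1 - s) * (v - u)"
    by (simp_all add: p_def algebra_simps)
  have "(1 - s) * (\<phi> p * (u - p) + \<kappa> / 2 * (u - p)\<^sup>2) + s * (\<phi> p * (v - p) + \<kappa> / 2 * (v - p)\<^sup>2)
      = s * (1 - s) * (\<kappa> / 2 * (v - u)\<^sup>2)"
    unfolding d by (simp add: power2_eq_square algebra_simps add_divide_distrib diff_divide_distrib)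
  ultimately have "s * (1 - s) * (\<kappa> / 2 * (v - u)\<^sup>2)
      \<le> (1 - s) * (antideriv \<phi> u - antideriv \<phi> p) + s * (antideriv \<phi> v - antideriv \<phi> p)"
    by (simp only:)
  then show ?thesis unfolding p_def[symmetric] by (simp add: algebra_simps)
qed

lemma antideriv_continuous:
  assumes "continuous_on {a..b} \<phi>" "0 \<in> {a..b}"
  shows "continuous_on {a..b} (antideriv \<phi>)"
  unfolding continuous_on_eq_continuous_within
  using antideriv_has_derivative[OF assms] DERIV_continuous by blast

lemma glr_loss_antideriv: "glr_loss \<phi> x y \<mu> = antideriv \<phi> (x \<bullet> \<mu>) - (x \<bullet> \<mu>) * y"
  by (simp add: glr_loss_def antideriv_def)

lemma power2_norm_convex_combination:
  fixes u v :: "'a::real_inner"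
  shows "(norm (u + s *\<^sub>R (v - u)))\<^sup>2 = (1 - s) * (norm u)\<^sup>2 + s * (norm v)\<^sup>2 - s * (1 - s) * (norm (v - u))\<^sup>2"
  unfolding power2_norm_eq_inner
  by (simp add: inner_add_left inner_add_right inner_diff_left inner_diff_right inner_commute algebra_simps)

section \<open>Growth of the FTRL objective around its minimiser\<close>

definition ftrl_obj ::
  "real \<Rightarrow> (real \<Rightarrow> real) \<Rightarrow> (nat \<Rightarrow> real ^ 'd) \<Rightarrow> (nat \<Rightarrow> real) \<Rightarrow> nat \<Rightarrow> real ^ 'd \<Rightarrow> real" where
  "ftrl_obj lam \<phi> x y t \<mu> = lam * (norm \<mu>)\<^sup>2 + (\<Sum>\<tau>=1..t. glr_loss \<phi> (x \<tau>) (y \<tau>) \<mu>)"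

text \<open>
  Only minimality along the segment from \<open>m\<close> to \<open>\<mu>\<close> matters, so this also holds when \<open>m\<close>
  lies on the boundary of the region where \<open>\<phi>\<close> is controlled.
\<close>

lemma ftrl_minimizer_growth:
  fixes m \<mu> :: "real ^ 'd"
  assumes act: "activation \<phi> I B \<kappa> K" and "0 \<in> I"
    and min: "\<And>\<nu>. ftrl_obj lam \<phi> x y t m \<le> ftrl_obj lam \<phi> x y t \<nu>"
    and m: "\<And>\<tau>. \<tau> \<in> {1..t} \<Longrightarrow> x \<tau> \<bullet> m \<in> I" and \<mu>: "\<And>\<tau>. \<tau> \<in> {1..t} \<Longrightarrow> x \<tau> \<bullet> \<mu> \<in> I"
  shows "ftrl_obj lam \<phi> x y t m + (lam * (norm (\<mu> - m))\<^sup>2 + \<kappa> / 2 * (\<Sum>\<tau>=1..t. (x \<tau> \<bullet> (\<mu> - m))\<^sup>2))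
    \<le> ftrl_obj lam \<phi> x y t \<mu>"
proof -
  define q where "q = lam * (norm (\<mu> - m))\<^sup>2 + \<kappa> / 2 * (\<Sum>\<tau>=1..t. (x \<tau> \<bullet> (\<mu> - m))\<^sup>2)"
  \<comment> \<open>Comparing the minimum with the point at fraction \<open>s = 1 - z\<close>
    towards \<open>\<mu>\<close> and cancelling \<open>s\<close> leaves the factor
    \<open>1 - s\<close>, which tends to 1 as that point moves back to \<open>m\<close>.\<close>
  have "z * q \<le> ftrl_obj lam \<phi> x y t \<mu> - ftrl_obj lam \<phi> x y t m" if z: "0 < z" "z < 1" for z
  proof -
    define s where "s = 1 - z"
    have s: "0 < s" "s \<le> 1" "z = 1 - s" using z by (auto simp: s_def)
    have "glr_loss \<phi> (x \<tau>) (y \<tau>) (m + s *\<^sub>R (\<mu> - m)) \<le>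
        (1 - s) * glr_loss \<phi> (x \<tau>) (y \<tau>) m + s * glr_loss \<phi> (x \<tau>) (y \<tau>) \<mu>
        - s * (1 - s) * (\<kappa> / 2 * (x \<tau> \<bullet> (\<mu> - m))\<^sup>2)" if "\<tau> \<in> {1..t}" for \<tau>
      using antideriv_strongly_convex[OF act \<open>0 \<in> I\<close> m[OF that] \<mu>[OF that], of s] s
      by (simp add: glr_loss_antideriv inner_add_right inner_diff_right algebra_simps)
    then have "(\<Sum>\<tau>=1..t. glr_loss \<phi> (x \<tau>) (y \<tau>) (m + s *\<^sub>R (\<mu> - m))) \<le>
        (\<Sum>\<tau>=1..t. (1 - s) * glr_loss \<phi> (x \<tau>) (y \<tau>) m + s * glr_loss \<phi> (x \<tau>) (y \<tau>) \<mu>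
        - s * (1 - s) * (\<kappa> / 2 * (x \<tau> \<bullet> (\<mu> - m))\<^sup>2))"
      by (intro sum_mono) auto
    also have "\<dots> = (1 - s) * (\<Sum>\<tau>=1..t. glr_loss \<phi> (x \<tau>) (y \<tau>) m)
        + s * (\<Sum>\<tau>=1..t. glr_loss \<phi> (x \<tau>) (y \<tau>) \<mu>)
        - s * (1 - s) * (\<kappa> / 2 * (\<Sum>\<tau>=1..t. (x \<tau> \<bullet> (\<mu> - m))\<^sup>2))"
      by (simp only: sum.distrib sum_subtractf sum_distrib_left)
    finally have "ftrl_obj lam \<phi> x y t (m + s *\<^sub>R (\<mu> - m))
        \<le> (1 - s) * ftrl_obj lam \<phi> x y t m + s * ftrl_obj lam \<phi> x y t \<mu> - s * (1 - s) * q"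
      unfolding ftrl_obj_def power2_norm_convex_combination q_def by (simp add: algebra_simps)
    with min[of "m + s *\<^sub>R (\<mu> - m)"]
    have "s * ((1 - s) * q) \<le> s * (ftrl_obj lam \<phi> x y t \<mu> - ftrl_obj lam \<phi> x y t m)"
      by (simp add: algebra_simps)
    then show ?thesis using s by simp
  qed
  then have "q \<le> ftrl_obj lam \<phi> x y t \<mu> - ftrl_obj lam \<phi> x y t m"
    by (rule field_le_mult_one_interval)
  then show ?thesis by (simp add: q_def)
qed

section \<open>Determinants of positive definite matrices\<close>

lemma linear_coeff_zero:
  fixes b c :: real
  assumes "\<And>s. 2 * s * b + s\<^sup>2 * c \<le> 0"
  shows "b = 0"
proof (rule ccontr)
  assume b: "b \<noteq> 0"
  \<comment> \<open>Small enough that the quadratic term cannot outweigh the linear one, and of the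
    same sign as \<open>b\<close>.\<close>
  define s where "s = b / (\<bar>c\<bar> + 1)"
  have s: "s * (\<bar>c\<bar> + 1) = b" unfolding s_def by simp
  have "s \<noteq> 0" using b s by auto
  have "0 < s\<^sup>2 * (\<bar>c\<bar> + 2)" using \<open>s \<noteq> 0\<close> by (simp add: add_nonneg_pos)
  also have "\<dots> \<le> s\<^sup>2 * (2 * \<bar>c\<bar> + 2 + c)" by (intro mult_left_mono) auto
  also have "\<dots> = 2 * s * b + s\<^sup>2 * c" unfolding s[symmetric] by (simp add: algebra_simps power2_eq_square)
  finally show False using assms[of s] by simp
qed

text \<open>A maximiser of the Rayleigh quotient on the unit sphere of \<open>S\<close> is an
  eigenvector: otherwise moving it along its residual, which stays in \<open>S\<close> by
  invariance, would increase the quotient.\<close>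

lemma self_adjoint_eigenvector:
  fixes f :: "'a::euclidean_space \<Rightarrow> 'a"
  assumes lin: "linear f" and adj: "\<And>v w. f v \<bullet> w = v \<bullet> f w"
    and S: "subspace S" and inv: "\<And>v. v \<in> S \<Longrightarrow> f v \<in> S" and ne: "S \<noteq> {0}"
  obtains v c where "v \<in> S" "norm v = 1" "f v = c *\<^sub>R v"
proof -
  obtain u where u: "u \<in> S" "u \<noteq> 0" using ne subspace_0[OF S] by blast
  have "u /\<^sub>R norm u \<in> S \<inter> sphere 0 1" using u S by (simp add: subspace_scale)
  moreover have "compact (S \<inter> sphere 0 1)"
    by (simp add: S closed_Int_compact closed_subspace)
  moreover have "continuous_on (S \<inter> sphere 0 1) (\<lambda>v. v \<bullet> f v)"
    by (intro continuous_intros linear_continuous_on linear_conv_bounded_linear[THEN iffD1] lin)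
  ultimately obtain v where v: "v \<in> S" "norm v = 1"
    and max: "\<And>w. w \<in> S \<Longrightarrow> norm w = 1 \<Longrightarrow> w \<bullet> f w \<le> v \<bullet> f v"
    using continuous_attains_sup[of "S \<inter> sphere 0 1" "\<lambda>v. v \<bullet> f v"]
    by (metis IntE IntI empty_iff mem_sphere_0)
  define c where "c = v \<bullet> f v"
  \<comment> \<open>Homogeneity extends maximality from the sphere to all of \<open>S\<close>, so
    that perturbed vectors need no normalisation.\<close>
  have le: "w \<bullet> f w - c * (w \<bullet> w) \<le> 0" if "w \<in> S" for w
  proof (cases "w = 0")
    case False
    have "(w /\<^sub>R norm w) \<bullet> f (w /\<^sub>R norm w) \<le> c"
      unfolding c_def using that False S by (intro max) (auto simp: subspace_scale)
    then have "(w \<bullet> f w) / (norm w)\<^sup>2 \<le> c"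
      by (simp add: linear_scale[OF lin] power2_eq_square divide_simps)
    then show ?thesis using False by (simp add: divide_simps power2_norm_eq_inner split: if_splits)
  qed (simp add: linear_0[OF lin])
  have "f v - c *\<^sub>R v = 0"
  proof -
    \<comment> \<open>Perturbing in the direction of the residual itself makes the first-order
      coefficient equal to \<open>w \<bullet> w\<close>.\<close>
    define w where "w = f v - c *\<^sub>R v"
    have w: "w \<in> S" unfolding w_def using v S inv by (simp add: subspace_diff subspace_scale)
    have "w \<bullet> w = 0"
    proof (rule linear_coeff_zero)
      fix s :: real
      have vv: "v \<bullet> v = 1" using v(2) by (simp add: norm_eq_1)
      have "(v + s *\<^sub>R w) \<bullet> f (v + s *\<^sub>R w) - c * ((v + s *\<^sub>R w) \<bullet> (v + s *\<^sub>R w)) \<le> 0"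
        using v(1) w S by (intro le) (simp add: subspace_add subspace_scale)
      moreover have "v \<bullet> f w = w \<bullet> f v" using adj[of v w] by (simp add: inner_commute)
      ultimately have "2 * s * (w \<bullet> f v - c * (v \<bullet> w)) + s\<^sup>2 * (w \<bullet> f w - c * (w \<bullet> w)) \<le> 0"
        using vv by (simp add: linear_add[OF lin] linear_scale[OF lin] inner_add_left inner_add_right
            c_def[symmetric] inner_commute[of w v] algebra_simps power2_eq_square)
      moreover have "w \<bullet> w = w \<bullet> f v - c * (v \<bullet> w)"
        by (subst (2) w_def) (simp add: inner_diff_right inner_commute)
      ultimately show "2 * s * (w \<bullet> w) + s\<^sup>2 * (w \<bullet> f w - c * (w \<bullet> w)) \<le> 0" by simp
    qed
    then show ?thesis by (simp add: w_def)
  qed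
  then show ?thesis using v that by simp
qed

text \<open>Splits off one eigenvector at a time: self-adjointness makes its orthogonal complement
  within \<open>S\<close> invariant again, of smaller dimension. The induction is the reason for
  stating this for all invariant subspaces.\<close>

lemma self_adjoint_orthonormal_eigenbasis:
  fixes f :: "'a::euclidean_space \<Rightarrow> 'a"
  assumes lin: "linear f" and adj: "\<And>v w. f v \<bullet> w = v \<bullet> f w"
    and "subspace S" and "\<And>v. v \<in> S \<Longrightarrow> f v \<in> S"
  shows "\<exists>B. B \<subseteq> S \<and> pairwise orthogonal B \<and> (\<forall>b\<in>B. norm b = 1 \<and> (\<exists>c. f b = c *\<^sub>R b)) \<and> span B = S"
  using assms(3,4)
proof (induction "dim S" arbitrary: S rule: less_induct)
  case less
  show ?case
  proof (cases "S = {0}")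
    case True
    then show ?thesis by (intro exI[of _ "{}"]) auto
  next
    case False
    then obtain v c where v: "v \<in> S" "norm v = 1" "f v = c *\<^sub>R v"
      using self_adjoint_eigenvector[OF lin adj less.prems] by metis
    have vv: "v \<bullet> v = 1" using v(2) by (simp add: norm_eq_1)
    define U where "U = {w \<in> S. w \<bullet> v = 0}"
    have U: "subspace U"
      using less.prems(1) unfolding U_def subspace_def by (auto simp: inner_add_left)
    have "v \<notin> U" by (simp add: U_def vv)
    then have "U \<subset> S" using v(1) by (auto simp: U_def simp del: inner_eq_zero_iff)
    then have "dim U < dim S"
      using U less.prems(1) by (metis dim_psubset span_eq_iff)
    moreover have "f w \<in> U" if "w \<in> U" for w
      using that less.prems(2) by (simp add: U_def adj v(3))
    ultimately obtain B where B: "B \<subseteq> U" "pairwise orthogonal B"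
      "\<forall>b\<in>B. norm b = 1 \<and> (\<exists>c. f b = c *\<^sub>R b)" "span B = U"
      using less.hyps[OF _ U] by metis
    have "span (insert v B) = S"
    proof
      show "span (insert v B) \<subseteq> S"
        using B(1) v(1) less.prems(1) by (intro span_minimal) (auto simp: U_def)
    next
      show "S \<subseteq> span (insert v B)"
      proof
        fix w assume w: "w \<in> S"
        have "w - (w \<bullet> v) *\<^sub>R v \<in> span B"
          using w v(1) less.prems(1) vv
          by (simp add: B(4) U_def inner_diff_left subspace_diff subspace_scale)
        then show "w \<in> span (insert v B)" by (auto simp: span_insert)
      qed
    qed
    moreover have "pairwise orthogonal (insert v B)"
      using B(1,2) by (auto simp: pairwise_insert orthogonal_def U_def inner_commute)
    ultimately show ?thesis
      using B v less.prems by (intro exI[of _ "insert v B"]) (auto simp: U_def)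
  qed
qed

lemma symmetric_matrix_diagonalization:
  fixes P :: "real ^ 'n ^ 'n"
  assumes "transpose P = P"
  obtains Q :: "real ^ 'n ^ 'n" and c where "orthogonal_matrix Q"
    and "P ** Q = Q ** (\<chi> i j. if i = j then c i else 0)"
    and "\<And>j. norm (column j Q) = 1" "\<And>j. P *v column j Q = c j *\<^sub>R column j Q"
proof -
  have adj: "(P *v v) \<bullet> w = v \<bullet> (P *v w)" for v w
    by (metis assms dot_lmul_matrix inner_commute transpose_matrix_vector)
  obtain B where B: "pairwise orthogonal B" "\<forall>b\<in>B. norm b = 1 \<and> (\<exists>c. P *v b = c *\<^sub>R b)"
    "span B = (UNIV :: (real ^ 'n) set)"
    using self_adjoint_orthonormal_eigenbasis[of "(*v) P" UNIV] adj by auto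
  have ind: "independent B"
    using B by (intro pairwise_orthogonal_independent) auto
  then have fin: "finite B" using independent_imp_finite by blast
  \<comment> \<open>A basis has as many elements as the index type, so its vectors can be indexed by
    that type and serve as columns.\<close>
  have "card B = CARD('n)"
    using ind B(3) by (metis dim_UNIV dim_eq_card_independent dim_span DIM_cart DIM_real mult.right_neutral)
  then obtain b where b: "bij_betw b (UNIV :: 'n set) B"
    using fin finite_same_card_bij by (metis finite)
  have "\<exists>c. P *v b j = c *\<^sub>R b j" "norm (b j) = 1" for j
    using b B(2) bij_betwE by blast+
  then obtain c where c: "\<And>j. P *v b j = c j *\<^sub>R b j" and n: "\<And>j. norm (b j) = 1" by metis
  define Q where "Q = (\<chi> i j. b j $ i)"
  have col: "column j Q = b j" for j by (simp add: Q_def column_def vec_eq_iff)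
  have orth: "b i \<bullet> b j = (if i = j then 1 else 0)" for i j
    using B(1) b n[of i] unfolding pairwise_def orthogonal_def
    by (metis bij_betw_def bij_betwE inj_eq norm_eq_1 UNIV_I)
  have "transpose Q ** Q = mat 1"
    using orth by (simp add: vec_eq_iff matrix_matrix_mult_def transpose_def Q_def mat_def inner_vec_def)
  then have "orthogonal_matrix Q" by (simp add: orthogonal_matrix)
  moreover have "P ** Q = Q ** (\<chi> i j. if i = j then c i else 0)"
  proof -
    have "(P ** Q) $ i $ j = (P *v b j) $ i" for i j
      by (simp add: matrix_matrix_mult_def matrix_vector_mult_def Q_def)
    moreover have "(Q ** (\<chi> i j. if i = j then c i else 0)) $ i $ j = b j $ i * c j" for i j
      by (simp add: matrix_matrix_mult_def Q_def if_distrib cong: if_cong)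
    ultimately show ?thesis by (simp add: vec_eq_iff c mult.commute)
  qed
  ultimately show ?thesis by (rule that[of Q c]) (simp_all add: col c n)
qed

text \<open>Hadamard-type bound: the inequality between the arithmetic and geometric means of the
  eigenvalues, in logarithmic form.\<close>

lemma positive_definite_ln_det_le:
  fixes P :: "real ^ 'n ^ 'n"
  assumes sym: "transpose P = P" and pos: "\<And>v. v \<noteq> 0 \<Longrightarrow> 0 < v \<bullet> (P *v v)"
  shows "0 < det P" and "ln (det P) \<le> real CARD('n) * ln (trace P / real CARD('n))"
proof -
  obtain Q :: "real ^ 'n ^ 'n" and c where Q: "orthogonal_matrix Q"
    and PQ: "P ** Q = Q ** (\<chi> i j. if i = j then c i else 0)"
    and n: "\<And>j. norm (column j Q) = 1" and ev: "\<And>j. P *v column j Q = c j *\<^sub>R column j Q"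
    using symmetric_matrix_diagonalization[OF sym] by blast
  define D :: "real ^ 'n ^ 'n" where "D = (\<chi> i j. if i = j then c i else 0)"
  have c: "0 < c j" for j
  proof -
    have "column j Q \<noteq> 0" using n[of j] by auto
    from pos[OF this] show ?thesis using n[of j] by (simp add: ev norm_eq_1)
  qed
  have "det Q \<noteq> 0" using det_orthogonal_matrix[OF Q] by auto
  moreover have "det P * det Q = det Q * det D" using PQ by (metis D_def det_mul)
  ultimately have "det P = det D" by simp
  also have "\<dots> = (\<Prod>i\<in>UNIV. c i)" by (subst det_diagonal) (auto simp: D_def)
  finally have det: "det P = (\<Prod>i\<in>UNIV. c i)" .
  have "P = Q ** D ** transpose Q"
    using PQ Q by (metis D_def matrix_mul_assoc matrix_mul_rid orthogonal_matrix_def)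
  then have "trace P = trace (transpose Q ** (Q ** D))" by (metis trace_mul_sym)
  also have "\<dots> = trace D" using Q by (metis matrix_mul_assoc matrix_mul_lid orthogonal_matrix_def)
  also have "\<dots> = (\<Sum>i\<in>UNIV. c i)" by (simp add: trace_def D_def)
  finally have tr: "trace P = (\<Sum>i\<in>UNIV. c i)" .
  show "0 < det P" unfolding det using c by (intro prod_pos) auto
  define m where "m = trace P / real CARD('n)"
  have "0 < m" unfolding m_def tr using c by (intro divide_pos_pos sum_pos) auto
  \<comment> \<open>The tangent of \<open>ln\<close> at the mean \<open>m\<close> of the
    eigenvalues; after summation the deviations from the mean cancel.\<close>
  have "ln (c i) \<le> c i / m - 1 + ln m" for i
    using ln_le_minus_one[of "c i / m"] c[of i] \<open>0 < m\<close> by (simp add: ln_div)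
  then have "(\<Sum>i\<in>UNIV. ln (c i)) \<le> (\<Sum>i\<in>(UNIV :: 'n set). c i / m - 1 + ln m)"
    by (intro sum_mono) auto
  also have "\<dots> = trace P / m - real CARD('n) + real CARD('n) * ln m"
    by (simp add: tr sum.distrib sum_subtractf sum_divide_distrib)
  also have "trace P / m = real CARD('n)" using \<open>0 < m\<close> by (auto simp: m_def)
  finally show "ln (det P) \<le> real CARD('n) * ln (trace P / real CARD('n))"
    using less_imp_neq[OF c] by (subst det, subst ln_prod) (auto simp: m_def)
qed

section \<open>Determinants under rank-one updates\<close>

lemma matrix_diff_mult_distrib:
  fixes X Y Z :: "real ^ 'n ^ 'n"
  shows "X ** (Y - Z) = X ** Y - X ** Z" and "(X - Y) ** Z = X ** Z - Y ** Z"
  by (simp_all add: vec_eq_iff matrix_matrix_mult_def sum_subtractf algebra_simps)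

text \<open>Rotating \<open>u\<close> onto a coordinate axis concentrates the rank-one part in a
  single column. What remains is the identity with one column replaced, whose determinant Cramer's
  rule reads off.\<close>

lemma det_identity_minus_rank_one:
  fixes u v :: "real ^ 'n"
  shows "det (mat 1 - (\<chi> i j. v $ i * u $ j)) = 1 - u \<bullet> v"
proof -
  fix k :: 'n
  have "norm u = norm (norm u *\<^sub>R axis k (1::real) :: real ^ 'n)" by simp
  then obtain f :: "real ^ 'n \<Rightarrow> real ^ 'n" where f: "orthogonal_transformation f" "f u = norm u *\<^sub>R axis k 1"
    using orthogonal_transformation_exists[of u "norm u *\<^sub>R axis k 1"] by metis
  define R where "R = matrix f"
  have R: "orthogonal_matrix R" and lin: "linear f"
    using f(1) orthogonal_transformation_matrix unfolding R_def by blast+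
  have Rv: "R *v w = f w" for w unfolding R_def by (simp add: lin)
  have outer: "R ** (\<chi> i j. v $ i * u $ j) = (\<chi> i j. f v $ i * u $ j)"
    by (simp add: vec_eq_iff matrix_matrix_mult_def Rv[symmetric] matrix_vector_mult_def
        sum_distrib_right mult.assoc)
  have outer2: "(\<chi> i j. f v $ i * u $ j) ** transpose R = (\<chi> i j. f v $ i * f u $ j)"
    by (simp add: vec_eq_iff matrix_matrix_mult_def Rv[of u, symmetric] matrix_vector_mult_def transpose_def
        sum_distrib_left mult.assoc mult.left_commute mult.commute)
  have det1: "det R * det (transpose R) = 1"
    using R by (metis det_I det_mul orthogonal_matrix_def)
  have "det (mat 1 - (\<chi> i j. v $ i * u $ j)) = det (R ** (mat 1 - (\<chi> i j. v $ i * u $ j)) ** transpose R)"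
    using det1 by (simp add: det_mul)
  also have "R ** (mat 1 - (\<chi> i j. v $ i * u $ j)) ** transpose R
      = (mat 1 - (\<chi> i j. f v $ i * f u $ j) :: real ^ 'n ^ 'n)"
    using R by (simp add: matrix_diff_mult_distrib outer outer2 orthogonal_matrix_def)
  also have "\<dots> = (\<chi> i j. if j = k then ((mat 1 :: real ^ 'n ^ 'n) *v (axis k 1 - norm u *\<^sub>R f v)) $ i
      else (mat 1 :: real ^ 'n ^ 'n) $ i $ j)"
    unfolding matrix_vector_mul_lid by (auto simp: f(2) vec_eq_iff mat_def axis_def)
  also have "det \<dots> = (axis k 1 - norm u *\<^sub>R f v) $ k * det (mat 1 :: real ^ 'n ^ 'n)"
    by (rule cramer_lemma)
  also have "\<dots> = 1 - f u \<bullet> f v"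
    by (simp add: f(2) inner_axis')
  also have "f u \<bullet> f v = u \<bullet> v"
    using f(1) by (simp add: orthogonal_transformation_def)
  finally show ?thesis .
qed

text \<open>Since \<open>x = P *v v\<close>, the factor \<open>P\<close> can be pulled out of the
  update. Naming a solution \<open>v\<close> in place of the inverse matrix keeps the statement free
  of inverses.\<close>

lemma det_minus_rank_one:
  fixes P :: "real ^ 'n ^ 'n" and x v :: "real ^ 'n"
  assumes "P *v v = x"
  shows "det (P - (\<chi> i j. k * x $ i * x $ j)) = det P * (1 - k * (x \<bullet> v))"
proof -
  have "P ** (mat 1 - (\<chi> i j. v $ i * (k *\<^sub>R x) $ j)) = P - (\<chi> i j. k * x $ i * x $ j)"
    unfolding assms[symmetric]
    by (simp add: matrix_diff_mult_distrib, simp add: vec_eq_iff matrix_matrix_mult_def matrix_vector_mult_def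
        sum_distrib_right sum_distrib_left mult.commute mult.left_commute)
  then have "det (P - (\<chi> i j. k * x $ i * x $ j)) = det P * det (mat 1 - (\<chi> i j. v $ i * (k *\<^sub>R x) $ j))"
    by (metis det_mul)
  also have "\<dots> = det P * (1 - k * (x \<bullet> v))" unfolding det_identity_minus_rank_one by simp
  finally show ?thesis .
qed

section \<open>The regularised Gram matrix\<close>

text \<open>Used with \<open>a = 2 * lam\<close> and \<open>k = \<kappa>\<close>: half the quadratic
  form is then the growth of the FTRL objective at its minimiser.\<close>

definition gram :: "real \<Rightarrow> real \<Rightarrow> (nat \<Rightarrow> real ^ 'd) \<Rightarrow> nat \<Rightarrow> real ^ 'd ^ 'd" where
  "gram a k x t = (\<chi> i j. (if i = j then a else 0) + (\<Sum>\<tau>=1..t. k * x \<tau> $ i * x \<tau> $ j))"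

text \<open>
  By the matrix determinant lemma this is \<open>x\<^sub>t\<^sup>T G\<^sub>t\<^sup>-\<^sup>1 x\<^sub>t\<close> with \<open>G\<^sub>t = gram a k x t\<close>; as a
  rational function of the entries it is evidently measurable and telescopes against \<open>ln det\<close>.
\<close>

definition width :: "real \<Rightarrow> real \<Rightarrow> (nat \<Rightarrow> real ^ 'd) \<Rightarrow> nat \<Rightarrow> real" where
  "width a k x t = (1 - det (gram a k x (t - 1)) / det (gram a k x t)) / k"

lemma gram_mult: "gram a k x t *v v = a *\<^sub>R v + (\<Sum>\<tau>=1..t. (k * (x \<tau> \<bullet> v)) *\<^sub>R x \<tau>)"
proof -
  have "(gram a k x t *v v) $ i = a * v $ i + (\<Sum>\<tau>=1..t. k * (x \<tau> \<bullet> v) * x \<tau> $ i)" for i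
  proof -
    have "(gram a k x t *v v) $ i = (\<Sum>j\<in>UNIV. (if i = j then a else 0) * v $ j)
        + (\<Sum>j\<in>UNIV. \<Sum>\<tau>=1..t. k * x \<tau> $ i * x \<tau> $ j * v $ j)"
      by (simp add: gram_def matrix_vector_mult_def algebra_simps sum.distrib sum_distrib_left)
    also have "(\<Sum>j\<in>UNIV. (if i = j then a else 0) * v $ j) = a * v $ i"
      by (simp add: if_distrib[of "\<lambda>c. c * _"] cong: if_cong)
    also have "(\<Sum>j\<in>UNIV. \<Sum>\<tau>=1..t. k * x \<tau> $ i * x \<tau> $ j * v $ j)
        = (\<Sum>\<tau>=1..t. \<Sum>j\<in>UNIV. k * x \<tau> $ i * x \<tau> $ j * v $ j)"
      by (rule sum.swap)
    finally show ?thesis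
      by (simp add: inner_vec_def sum_distrib_left sum_distrib_right mult.assoc mult.commute mult.left_commute)
  qed
  then show ?thesis by (simp add: vec_eq_iff)
qed

lemma gram_quadratic: "v \<bullet> (gram a k x t *v v) = a * (norm v)\<^sup>2 + k * (\<Sum>\<tau>=1..t. (x \<tau> \<bullet> v)\<^sup>2)"
  unfolding power2_norm_eq_inner
  by (simp add: gram_mult inner_add_right inner_sum_right sum_distrib_left
      inner_commute power2_eq_square mult.assoc)

lemma gram_symmetric: "transpose (gram a k x t) = gram a k x t"
  by (simp add: gram_def transpose_def vec_eq_iff mult.assoc mult.commute mult.left_commute)

lemma gram_pos_definite:
  assumes "0 < a" "0 \<le> k" "v \<noteq> 0"
  shows "0 < v \<bullet> (gram a k x t *v v)"
  unfolding gram_quadratic using assms by (intro add_pos_nonneg mult_pos_pos mult_nonneg_nonneg sum_nonneg) auto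

lemma gram_pred:
  assumes "1 \<le> t"
  shows "gram a k x (t - 1) = gram a k x t - (\<chi> i j. k * x t $ i * x t $ j)"
proof -
  obtain s where "t = Suc s" using assms by (metis Suc_le_D One_nat_def)
  then show ?thesis by (simp add: gram_def vec_eq_iff)
qed

lemma trace_gram: "trace (gram a k x t) = a * CARD('d) + k * (\<Sum>\<tau>=1..t. (norm (x \<tau> :: real ^ 'd))\<^sup>2)"
proof -
  have "trace (gram a k x t) = a * CARD('d) + (\<Sum>i\<in>UNIV. \<Sum>\<tau>=1..t. k * x \<tau> $ i * x \<tau> $ i)"
    by (simp add: trace_def gram_def sum.distrib)
  also have "(\<Sum>i\<in>UNIV. \<Sum>\<tau>=1..t. k * x \<tau> $ i * x \<tau> $ i) = (\<Sum>\<tau>=1..t. \<Sum>i\<in>UNIV. k * x \<tau> $ i * x \<tau> $ i)"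
    by (rule sum.swap)
  also have "\<dots> = k * (\<Sum>\<tau>=1..t. (norm (x \<tau>))\<^sup>2)"
    by (simp only: power2_norm_eq_inner inner_vec_def sum_distrib_left inner_real_def mult.assoc)
  finally show ?thesis .
qed

lemma det_gram_pos: "0 < a \<Longrightarrow> 0 \<le> k \<Longrightarrow> 0 < det (gram a k x t)"
  by (intro positive_definite_ln_det_le(1) gram_symmetric gram_pos_definite)

text \<open>Makes the determinant ratio usable as a quadratic form: later facts about
  \<open>width\<close> argue through this \<open>v\<close>, which stands for the inverse Gram matrix
  applied to \<open>x t\<close>.\<close>

lemma width_solution:
  assumes "0 < a" "0 < k" "1 \<le> t"
  obtains v where "gram a k x t *v v = x t" "x t \<bullet> v = width a k x t"
proof -
  have det: "0 < det (gram a k x t)" using det_gram_pos assms by (metis less_imp_le)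
  then have "invertible (gram a k x t)" by (simp add: invertible_det_nz)
  then obtain R where "gram a k x t ** R = mat 1" unfolding invertible_def by blast
  then have sol: "gram a k x t *v (R *v x t) = x t" by (simp add: matrix_vector_mul_assoc)
  have "det (gram a k x (t - 1)) = det (gram a k x t) * (1 - k * (x t \<bullet> (R *v x t)))"
    unfolding gram_pred[OF assms(3)] by (rule det_minus_rank_one[OF sol])
  then have "x t \<bullet> (R *v x t) = width a k x t"
    using det assms by (simp add: width_def field_simps)
  then show ?thesis using sol that by blast
qed

lemma width_nonneg:
  assumes "0 < a" "0 < k" "1 \<le> t"
  shows "0 \<le> width a k x t"
proof -
  obtain v where v: "gram a k x t *v v = x t" "x t \<bullet> v = width a k x t"
    using width_solution[OF assms] by blast
  have "0 \<le> v \<bullet> (gram a k x t *v v)"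
    using gram_pos_definite[of a k v x t] assms by (cases "v = 0") auto
  then show ?thesis by (simp only: v inner_commute[of v])
qed

text \<open>The Gram matrix dominates \<open>a\<close> times the identity. In terms of
  \<open>v\<close>, the width is at least \<open>a * (norm v)\<^sup>2\<close> and, by
  Cauchy-Schwarz, at most \<open>norm (x t) * norm v\<close>; eliminating \<open>norm v\<close>
  gives the bound.\<close>

lemma width_le:
  assumes "0 < a" "0 < k" "1 \<le> t"
  shows "width a k x t \<le> (norm (x t))\<^sup>2 / a"
proof -
  obtain v where v: "gram a k x t *v v = x t" "x t \<bullet> v = width a k x t"
    using width_solution[OF assms] by blast
  have "width a k x t = a * (norm v)\<^sup>2 + k * (\<Sum>\<tau>=1..t. (x \<tau> \<bullet> v)\<^sup>2)"
    using gram_quadratic[of v a k x t] v by (simp add: inner_commute)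
  moreover have "0 \<le> k * (\<Sum>\<tau>=1..t. (x \<tau> \<bullet> v)\<^sup>2)"
    using assms by (intro mult_nonneg_nonneg sum_nonneg) auto
  ultimately have le: "a * (norm v)\<^sup>2 \<le> width a k x t" by simp
  have "0 \<le> (norm (x t) - a * norm v)\<^sup>2" by simp
  then have "2 * a * (norm (x t) * norm v) \<le> (norm (x t))\<^sup>2 + a * (a * (norm v)\<^sup>2)"
    by (simp add: power2_eq_square algebra_simps)
  also have "a * (a * (norm v)\<^sup>2) \<le> a * width a k x t"
    using le assms by (intro mult_left_mono) auto
  finally have "2 * a * (norm (x t) * norm v) \<le> (norm (x t))\<^sup>2 + a * width a k x t" by simp
  moreover have "2 * a * width a k x t \<le> 2 * a * (norm (x t) * norm v)"
    using assms norm_cauchy_schwarz[of "x t" v] by (simp add: v(2))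
  ultimately have "a * width a k x t \<le> (norm (x t))\<^sup>2" by linarith
  then show ?thesis using assms by (simp add: field_simps)
qed

text \<open>Completing the square: the right-hand side, as a function of \<open>d\<close>, is
  minimal at \<open>- p *\<^sub>R v\<close>, where it equals the left-hand side.\<close>

lemma width_dual:
  assumes "0 < a" "0 < k" "1 \<le> t"
  shows "- (p\<^sup>2 * width a k x t / 2) \<le> p * (x t \<bullet> d) + (a * (norm d)\<^sup>2 + k * (\<Sum>\<tau>=1..t. (x \<tau> \<bullet> d)\<^sup>2)) / 2"
proof -
  let ?G = "gram a k x t"
  obtain v where v: "?G *v v = x t" "x t \<bullet> v = width a k x t"
    using width_solution[OF assms] by blast
  have "v \<bullet> (?G *v d) = x t \<bullet> d"
    by (metis dot_lmul_matrix gram_symmetric inner_commute transpose_matrix_vector v(1))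
  moreover have "0 \<le> (d + p *\<^sub>R v) \<bullet> (?G *v (d + p *\<^sub>R v))"
    using gram_pos_definite[of a k "d + p *\<^sub>R v" x t] assms by (cases "d + p *\<^sub>R v = 0") auto
  moreover have "v \<bullet> x t = width a k x t" using v(2) by (simp add: inner_commute)
  ultimately have "0 \<le> d \<bullet> (?G *v d) + 2 * p * (x t \<bullet> d) + p\<^sup>2 * width a k x t"
    by (simp add: matrix_vector_right_distrib matrix_vector_mult_scaleR v(1) inner_add_left inner_add_right
        inner_commute[of d "x t"] power2_eq_square algebra_simps)
  then show ?thesis unfolding gram_quadratic by (simp add: field_simps)
qed

text \<open>With z the ratio of consecutive determinants, \<open>k\<close> times the width is 1 -
  1/z, which is at most ln z.\<close>

lemma elliptical_potential:
  fixes x :: "nat \<Rightarrow> real ^ 'd"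
  assumes "0 < a" "0 < k" and x: "\<And>t. t \<in> {1..n} \<Longrightarrow> norm (x t) \<le> A"
  shows "k * (\<Sum>t=1..n. width a k x t) \<le> real CARD('d) * ln (1 + k * n * A\<^sup>2 / (a * CARD('d)))"
proof -
  let ?D = "\<lambda>t. ln (det (gram a k x t))" and ?d = "real CARD('d)"
  have pos: "0 < det (gram a k x t)" for t using assms det_gram_pos by (metis less_imp_le)
  have "k * width a k x t \<le> ?D t - ?D (t - 1)" for t
  proof -
    have "?D (t - 1) - ?D t \<le> det (gram a k x (t - 1)) / det (gram a k x t) - 1"
      using ln_le_minus_one[of "det (gram a k x (t - 1)) / det (gram a k x t)"] pos[of t] pos[of "t - 1"] by (simp add: ln_div)
    then show ?thesis using \<open>0 < k\<close> by (simp add: width_def)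
  qed
  then have "k * (\<Sum>t=1..n. width a k x t) \<le> (\<Sum>t=1..n. ?D t - ?D (t - 1))"
    unfolding sum_distrib_left by (intro sum_mono) auto
  also have "\<dots> = ?D n - ?D 0"
    by (induction n) auto
  \<comment> \<open>The trace depends on the features only through their norms, so the bound holds
    uniformly over adaptive choices.\<close>
  also have "?D n \<le> ?d * ln (trace (gram a k x n) / ?d)"
    using assms by (intro positive_definite_ln_det_le(2) gram_symmetric gram_pos_definite) auto
  also have "?D 0 = ?d * ln a"
  proof -
    have "det (gram a k x 0) = a ^ CARD('d)"
      by (subst det_diagonal) (auto simp: gram_def)
    then show ?thesis using \<open>0 < a\<close> by (simp add: ln_realpow)
  qed
  also have "?d * ln (trace (gram a k x n) / ?d) - ?d * ln a = ?d * ln (trace (gram a k x n) / ?d / a)"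
  proof -
    have "0 < trace (gram a k x n)" unfolding trace_gram
      using assms by (intro add_pos_nonneg mult_pos_pos mult_nonneg_nonneg sum_nonneg) auto
    then have "ln (trace (gram a k x n) / ?d / a) = ln (trace (gram a k x n) / ?d) - ln a"
      using \<open>0 < a\<close> ln_div[of "trace (gram a k x n) / ?d" a] by simp
    then show ?thesis by (simp only: right_diff_distrib)
  qed
  also have "\<dots> \<le> ?d * ln (1 + k * n * A\<^sup>2 / (a * ?d))"
  proof -
    have "(\<Sum>\<tau>=1..n. (norm (x \<tau>))\<^sup>2) \<le> (\<Sum>\<tau>=1..n. A\<^sup>2)"
      using x by (intro sum_mono power_mono) auto
    then have "k * (\<Sum>\<tau>=1..n. (norm (x \<tau>))\<^sup>2) \<le> k * (n * A\<^sup>2)"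
      using \<open>0 < k\<close> by (intro mult_left_mono) auto
    then have "k * (\<Sum>\<tau>=1..n. (norm (x \<tau>))\<^sup>2) / (a * ?d) \<le> k * (n * A\<^sup>2) / (a * ?d)"
      using \<open>0 < a\<close> by (intro divide_right_mono) auto
    then have "trace (gram a k x n) / ?d / a \<le> 1 + k * n * A\<^sup>2 / (a * ?d)"
      unfolding trace_gram using \<open>0 < a\<close> by (simp add: add_divide_distrib mult.assoc mult.commute)
    moreover have "0 < trace (gram a k x n) / ?d / a" unfolding trace_gram
      using assms by (intro divide_pos_pos add_pos_nonneg mult_pos_pos mult_nonneg_nonneg sum_nonneg) auto
    ultimately show ?thesis by (intro mult_left_mono ln_mono) auto
  qed
  finally show ?thesis by simp
qed

section \<open>Regret along a single path\<close>

text \<open>In round 1 the objective is the bare regulariser, minimised by the prescribed start 0.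
  So the first round can be treated like all others.\<close>

lemma ftrl_iterates_minimal:
  assumes "ftrl_iterates lam \<phi> x y T \<mu>h" "0 \<le> lam" "t \<in> {1..T}"
  shows "ftrl_obj lam \<phi> x y (t - 1) (\<mu>h t) \<le> ftrl_obj lam \<phi> x y (t - 1) \<nu>"
proof (cases "t = 1")
  case True
  then show ?thesis using assms by (simp add: ftrl_iterates_def ftrl_obj_def)
next
  case False
  then have "1 \<le> t - 1" "t - 1 < T" "Suc (t - 1) = t" using assms(3) by auto
  then have "is_arg_min (ftrl_obj lam \<phi> x y (t - 1)) (\<lambda>\<mu>. True) (\<mu>h t)"
    using assms(1) unfolding ftrl_iterates_def ftrl_obj_def[abs_def] by (metis (no_types))
  then show ?thesis by (auto simp: is_arg_min_linorder)
qed

lemma ftrl_obj_pred: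
  assumes "1 \<le> t"
  shows "ftrl_obj lam \<phi> x y t \<mu> = ftrl_obj lam \<phi> x y (t - 1) \<mu> + glr_loss \<phi> (x t) (y t) \<mu>"
proof -
  obtain s where "t = Suc s" using assms by (metis Suc_le_D One_nat_def)
  then show ?thesis by (simp add: ftrl_obj_def)
qed

locale ftrl_path =
  fixes \<phi> :: "real \<Rightarrow> real" and I :: "real set" and B \<kappa> K A lam :: real
    and x :: "nat \<Rightarrow> real ^ 'd" and \<epsilon> :: "nat \<Rightarrow> real" and T :: nat
    and \<mu>s :: "real ^ 'd" and \<mu>h :: "nat \<Rightarrow> real ^ 'd"
  assumes act: "activation \<phi> I B \<kappa> K" and \<mu>s_le: "norm \<mu>s \<le> B"
    and x_le: "\<And>t. t \<in> {1..T} \<Longrightarrow> norm (x t) \<le> A"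
    and lam_eq: "lam = 4 * A\<^sup>2 * K\<^sup>2 / \<kappa>" and lam_pos: "0 < lam"
    and iter: "ftrl_iterates lam \<phi> x (glr_label \<phi> \<mu>s x \<epsilon>) T \<mu>h"
    and args: "args_within I x \<mu>s \<mu>h T"
begin

abbreviation "y \<equiv> glr_label \<phi> \<mu>s x \<epsilon>"
abbreviation "gap t \<equiv> x t \<bullet> (\<mu>h t - \<mu>s)"
abbreviation "w t \<equiv> width (2 * lam) \<kappa> x t"

lemma kappa_pos: "0 < \<kappa>"
  using act by (rule activation_pos)

lemma zero_in: "0 \<in> I"
  using activation_zero[OF act] \<mu>s_le norm_ge_zero order_trans by blast

lemma K_pos: "0 < K"
  using activation_slope_le[OF act zero_in] kappa_pos by simp

lemma true_in: "t \<in> {1..T} \<Longrightarrow> x t \<bullet> \<mu>s \<in> I"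
  using args by (auto simp: args_within_def inner_commute)

lemma iterate_in: "t \<in> {1..T} \<Longrightarrow> \<tau> \<in> {1..t} \<Longrightarrow> x \<tau> \<bullet> \<mu>h t \<in> I"
  using args by (auto simp: args_within_def inner_commute)

lemma label: "y t = \<phi> (x t \<bullet> \<mu>s) + \<epsilon> t"
  by (simp add: glr_label_def inner_commute)

lemma w_nonneg: "1 \<le> t \<Longrightarrow> 0 \<le> w t"
  using lam_pos kappa_pos by (intro width_nonneg) auto

lemma w_le: "t \<in> {1..T} \<Longrightarrow> w t \<le> \<kappa> / (8 * K\<^sup>2)"
proof -
  assume t: "t \<in> {1..T}"
  have "w t \<le> (norm (x t))\<^sup>2 / (2 * lam)"
    using lam_pos kappa_pos t by (intro width_le) auto
  also have "\<dots> \<le> A\<^sup>2 / (2 * lam)"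
    using x_le[OF t] lam_pos by (intro divide_right_mono power_mono) auto
  also have "\<dots> = \<kappa> / (8 * K\<^sup>2)"
  proof -
    have "A \<noteq> 0" using lam_pos lam_eq by auto
    then show ?thesis using kappa_pos K_pos by (simp add: lam_eq field_simps)
  qed
  finally show ?thesis .
qed

text \<open>Stability of one round. The growth at the minimiser involves the features up to
  \<open>t - 1\<close>; the loss of round \<open>t\<close> adds its slope \<open>p\<close> at the
  prediction and the missing curvature term, which completes the quadratic form of the Gram matrix
  at \<open>t\<close>. Its minimum over \<open>d\<close> costs
  \<open>p\<^sup>2 * w t / 2\<close>.\<close>

lemma leader_step:
  assumes t: "t \<in> {1..T}" and \<mu>: "\<And>\<tau>. \<tau> \<in> {1..t} \<Longrightarrow> x \<tau> \<bullet> \<mu> \<in> I"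
  shows "ftrl_obj lam \<phi> x y t (\<mu>h t)
    \<le> ftrl_obj lam \<phi> x y t \<mu> + (\<phi> (x t \<bullet> \<mu>h t) - y t)\<^sup>2 * w t / 2"
proof -
  define d where "d = \<mu> - \<mu>h t"
  define p where "p = \<phi> (x t \<bullet> \<mu>h t) - y t"
  have t': "1 \<le> t" using t by simp
  have "ftrl_obj lam \<phi> x y (t - 1) (\<mu>h t)
      + (lam * (norm d)\<^sup>2 + \<kappa> / 2 * (\<Sum>\<tau>=1..t-1. (x \<tau> \<bullet> d)\<^sup>2)) \<le> ftrl_obj lam \<phi> x y (t - 1) \<mu>"
    unfolding d_def using lam_pos t iterate_in[OF t] \<mu>
    by (intro ftrl_minimizer_growth[OF act zero_in] ftrl_iterates_minimal[OF iter]) auto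
  moreover have "\<phi> (x t \<bullet> \<mu>h t) * (x t \<bullet> d) + \<kappa> / 2 * (x t \<bullet> d)\<^sup>2
      \<le> antideriv \<phi> (x t \<bullet> \<mu>) - antideriv \<phi> (x t \<bullet> \<mu>h t)"
    using antideriv_bregman[OF act zero_in iterate_in[OF t, of t] \<mu>[of t]] t
    by (simp add: d_def inner_diff_right)
  then have "p * (x t \<bullet> d) + \<kappa> / 2 * (x t \<bullet> d)\<^sup>2
      \<le> glr_loss \<phi> (x t) (y t) \<mu> - glr_loss \<phi> (x t) (y t) (\<mu>h t)"
    by (simp add: glr_loss_antideriv p_def d_def inner_diff_right algebra_simps)
  moreover have "- (p\<^sup>2 * w t / 2)
      \<le> p * (x t \<bullet> d) + (2 * lam * (norm d)\<^sup>2 + \<kappa> * (\<Sum>\<tau>=1..t. (x \<tau> \<bullet> d)\<^sup>2)) / 2"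
    using lam_pos kappa_pos t' by (intro width_dual) auto
  moreover have "(\<Sum>\<tau>=1..t. (x \<tau> \<bullet> d)\<^sup>2) = (\<Sum>\<tau>=1..t-1. (x \<tau> \<bullet> d)\<^sup>2) + (x t \<bullet> d)\<^sup>2"
    using t' by (cases t) auto
  ultimately show ?thesis
    unfolding ftrl_obj_pred[OF t'] p_def[symmetric] by (simp add: algebra_simps add_divide_distrib)
qed

text \<open>The comparator must be arbitrary: the induction hypothesis is applied with the next
  iterate \<open>\<mu>h (Suc n)\<close>, whose arguments are admissible by
  \<open>iterate_in\<close>. Adding the loss of round \<open>Suc n\<close> turns its objective into
  the next one, and \<open>leader_step\<close> exchanges it for \<open>\<mu>\<close>.\<close>

lemma be_the_leader:
  assumes "n \<le> T" and "\<And>\<tau>. \<tau> \<in> {1..n} \<Longrightarrow> x \<tau> \<bullet> \<mu> \<in> I"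
  shows "(\<Sum>t=1..n. glr_loss \<phi> (x t) (y t) (\<mu>h t))
    \<le> ftrl_obj lam \<phi> x y n \<mu> + (\<Sum>t=1..n. (\<phi> (x t \<bullet> \<mu>h t) - y t)\<^sup>2 * w t / 2)"
  using assms
proof (induction n arbitrary: \<mu>)
  case 0
  then show ?case using lam_pos by (simp add: ftrl_obj_def)
next
  case (Suc n)
  have n: "Suc n \<in> {1..T}" using Suc.prems(1) by auto
  have "(\<Sum>t=1..n. glr_loss \<phi> (x t) (y t) (\<mu>h t))
    \<le> ftrl_obj lam \<phi> x y n (\<mu>h (Suc n)) + (\<Sum>t=1..n. (\<phi> (x t \<bullet> \<mu>h t) - y t)\<^sup>2 * w t / 2)"
    using iterate_in[OF n] Suc.prems(1) by (intro Suc.IH) auto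
  moreover have "ftrl_obj lam \<phi> x y (Suc n) (\<mu>h (Suc n))
    = ftrl_obj lam \<phi> x y n (\<mu>h (Suc n)) + glr_loss \<phi> (x (Suc n)) (y (Suc n)) (\<mu>h (Suc n))"
    using ftrl_obj_pred[of "Suc n"] by simp
  ultimately show ?case using leader_step[OF n Suc.prems(2)] by simp
qed

text \<open>The residual at the prediction is the error \<open>a\<close> against the noiseless label
  minus the noise. The Lipschitz bound compares \<open>a\<close> with \<open>gap t\<close>, and the
  factor \<open>K\<^sup>2\<close> it costs is cancelled by the bound on \<open>w t\<close>.\<close>

lemma regret_upper:
  "stoc_regret \<phi> x y \<mu>s \<mu>h T
    \<le> lam * B\<^sup>2 + \<kappa> / 8 * (\<Sum>t=1..T. (gap t)\<^sup>2) + (\<Sum>t=1..T. (\<epsilon> t)\<^sup>2 * w t)"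
proof -
  have "(\<phi> (x t \<bullet> \<mu>h t) - y t)\<^sup>2 * w t / 2 \<le> \<kappa> / 8 * (gap t)\<^sup>2 + (\<epsilon> t)\<^sup>2 * w t" if t: "t \<in> {1..T}" for t
  proof -
    define a where "a = \<phi> (x t \<bullet> \<mu>h t) - \<phi> (x t \<bullet> \<mu>s)"
    have "\<bar>a\<bar> \<le> K * \<bar>gap t\<bar>"
      using activation_lipschitz[OF act iterate_in[OF t, of t] true_in[OF t]] t
      by (simp add: a_def inner_diff_right)
    then have "a\<^sup>2 \<le> K\<^sup>2 * (gap t)\<^sup>2"
      using power_mono[of "\<bar>a\<bar>" "K * \<bar>gap t\<bar>" 2] by (simp add: power_mult_distrib)
    then have "a\<^sup>2 * w t \<le> K\<^sup>2 * (gap t)\<^sup>2 * w t"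
      using w_nonneg t by (intro mult_right_mono) auto
    also have "\<dots> \<le> K\<^sup>2 * (gap t)\<^sup>2 * (\<kappa> / (8 * K\<^sup>2))"
      using w_le[OF t] by (intro mult_left_mono) auto
    also have "\<dots> = \<kappa> / 8 * (gap t)\<^sup>2" using K_pos by simp
    finally have 1: "a\<^sup>2 * w t \<le> \<kappa> / 8 * (gap t)\<^sup>2" .
    have "0 \<le> (a + \<epsilon> t)\<^sup>2" by simp
    then have "(a - \<epsilon> t)\<^sup>2 / 2 \<le> a\<^sup>2 + (\<epsilon> t)\<^sup>2" by (simp add: power2_eq_square algebra_simps)
    then have "(a - \<epsilon> t)\<^sup>2 / 2 * w t \<le> (a\<^sup>2 + (\<epsilon> t)\<^sup>2) * w t"
      using w_nonneg t by (intro mult_right_mono) auto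
    with 1 show ?thesis unfolding label by (simp add: a_def algebra_simps)
  qed
  then have "(\<Sum>t=1..T. (\<phi> (x t \<bullet> \<mu>h t) - y t)\<^sup>2 * w t / 2)
      \<le> (\<Sum>t=1..T. \<kappa> / 8 * (gap t)\<^sup>2 + (\<epsilon> t)\<^sup>2 * w t)"
    by (intro sum_mono) auto
  also have "\<dots> = \<kappa> / 8 * (\<Sum>t=1..T. (gap t)\<^sup>2) + (\<Sum>t=1..T. (\<epsilon> t)\<^sup>2 * w t)"
    by (simp only: sum.distrib sum_distrib_left)
  finally have "(\<Sum>t=1..T. (\<phi> (x t \<bullet> \<mu>h t) - y t)\<^sup>2 * w t / 2)
      \<le> \<kappa> / 8 * (\<Sum>t=1..T. (gap t)\<^sup>2) + (\<Sum>t=1..T. (\<epsilon> t)\<^sup>2 * w t)" .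
  moreover have "lam * (norm \<mu>s)\<^sup>2 \<le> lam * B\<^sup>2"
    using \<mu>s_le lam_pos by (intro mult_left_mono power_mono) auto
  ultimately show ?thesis
    using be_the_leader[of T \<mu>s] true_in by (simp add: stoc_regret_def ftrl_obj_def)
qed

text \<open>Bregman divergences from the true parameter minus a noise sum. The form serves the lower
  bound and also shows that the regret is measurable.\<close>

lemma regret_eq:
  "stoc_regret \<phi> x y \<mu>s \<mu>h T = (\<Sum>t=1..T. antideriv \<phi> (x t \<bullet> \<mu>h t) - antideriv \<phi> (x t \<bullet> \<mu>s)
    - \<phi> (x t \<bullet> \<mu>s) * gap t - gap t * \<epsilon> t)"
  unfolding stoc_regret_def sum_subtractf[symmetric]
  by (intro sum.cong refl) (simp add: glr_loss_antideriv label inner_diff_right algebra_simps)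

lemma regret_lower:
  "\<kappa> / 2 * (\<Sum>t=1..T. (gap t)\<^sup>2) - (\<Sum>t=1..T. gap t * \<epsilon> t) \<le> stoc_regret \<phi> x y \<mu>s \<mu>h T"
  unfolding regret_eq sum_distrib_left sum_subtractf[symmetric]
proof (rule sum_mono)
  fix t assume t: "t \<in> {1..T}"
  then show "\<kappa> / 2 * (gap t)\<^sup>2 - gap t * \<epsilon> t \<le> antideriv \<phi> (x t \<bullet> \<mu>h t) - antideriv \<phi> (x t \<bullet> \<mu>s)
    - \<phi> (x t \<bullet> \<mu>s) * gap t - gap t * \<epsilon> t"
    using antideriv_bregman[OF act zero_in true_in[OF t] iterate_in[OF t, of t]]
    by (simp add: inner_diff_right)
qed

text \<open>
  The quadratic gap term that the upper bound pays for is recovered from the lower bound,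
  which carries a four times larger coefficient.
\<close>

lemma regret_bound:
  assumes "(\<Sum>t=1..T. gap t * \<epsilon> t) \<le> \<kappa> / 8 * (\<Sum>t=1..T. (gap t)\<^sup>2) + E1"
    and "(\<Sum>t=1..T. (\<epsilon> t)\<^sup>2 * w t) \<le> E2"
  shows "stoc_regret \<phi> x y \<mu>s \<mu>h T \<le> 3 / 2 * (lam * B\<^sup>2 + E2) + E1 / 2"
  using assms regret_upper regret_lower by argo

end

context ftrl_path
begin

text \<open>The claimed constants leave slack: the elimination produces 6, 3, 2 and 3/4 where the
  statement has 8, 34, 4 and 6, in terms of \<open>P\<close>, the logarithmic term, \<open>Q\<close>
  and \<open>R\<close>.\<close>

lemma regret_explicit_bound:
  assumes L: "0 \<le> L"
    and lin: "(\<Sum>t=1..T. gap t * \<epsilon> t) \<le> \<kappa> / 8 * (\<Sum>t=1..T. (gap t)\<^sup>2) + \<sigma>\<^sup>2 / (2 * (\<kappa> / 8)) * L"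
    and quad: "(\<Sum>t=1..T. (\<epsilon> t)\<^sup>2 * w t) \<le> 2 * \<sigma>\<^sup>2 * (\<Sum>t=1..T. w t) + 4 * \<sigma>\<^sup>2 * (\<kappa> / (8 * K\<^sup>2)) * L"
  shows "stoc_regret \<phi> x y \<mu>s \<mu>h T
    \<le> 34 / \<kappa> * \<sigma>\<^sup>2 * real CARD('d)
          * ln ((4 * real CARD('d) * K\<^sup>2 + real T * \<kappa>\<^sup>2) / (4 * real CARD('d) * K\<^sup>2))
      + 8 * K\<^sup>2 * A\<^sup>2 * B\<^sup>2 / \<kappa>
      + 2 * (2 / \<kappa> + 3 * \<kappa> / K\<^sup>2) * \<sigma>\<^sup>2 * L"
proof -
  let ?d = "real CARD('d)"
  define X where "X = (4 * ?d * K\<^sup>2 + real T * \<kappa>\<^sup>2) / (4 * ?d * K\<^sup>2)"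
  have A: "A \<noteq> 0" using lam_pos lam_eq by auto
  have X: "X = 1 + real T * \<kappa>\<^sup>2 / (4 * ?d * K\<^sup>2)"
    using K_pos by (simp add: X_def add_divide_distrib)
  have "1 \<le> X" unfolding X by simp
  have "\<kappa> * (\<Sum>t=1..T. w t) \<le> ?d * ln (1 + \<kappa> * T * A\<^sup>2 / (2 * lam * ?d))"
    using lam_pos kappa_pos x_le by (intro elliptical_potential) auto
  also have "\<dots> \<le> ?d * ln X"
  proof (intro mult_left_mono ln_mono)
    \<comment> \<open>\<open>A\<^sup>2\<close> cancels against \<open>lam\<close>, leaving T
      \<kappa>^2 / (8 d K^2), half of what \<open>X\<close> allows.\<close>
    have "\<kappa> * T * A\<^sup>2 / (2 * lam * ?d) = real T * \<kappa>\<^sup>2 / (4 * ?d * K\<^sup>2) / 2"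
      using A kappa_pos K_pos by (simp add: lam_eq power2_eq_square field_simps)
    also have "\<dots> \<le> real T * \<kappa>\<^sup>2 / (4 * ?d * K\<^sup>2)"
    proof -
      have half: "q / 2 \<le> q" if "0 \<le> q" for q :: real using that by simp
      show ?thesis by (rule half) simp
    qed
    finally show "1 + \<kappa> * T * A\<^sup>2 / (2 * lam * ?d) \<le> X" unfolding X by simp
    show "0 < 1 + \<kappa> * T * A\<^sup>2 / (2 * lam * ?d)"
      using lam_pos kappa_pos by (intro add_pos_nonneg divide_nonneg_nonneg mult_nonneg_nonneg) auto
  qed simp
  finally have "(\<Sum>t=1..T. w t) \<le> ?d * ln X / \<kappa>"
    using kappa_pos by (simp add: pos_le_divide_eq mult.commute)
  then have "3 * \<sigma>\<^sup>2 * (\<Sum>t=1..T. w t) \<le> 3 * \<sigma>\<^sup>2 * (?d * ln X / \<kappa>)"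
    by (intro mult_left_mono) auto
  also have "\<dots> = 3 * (\<sigma>\<^sup>2 * ?d * ln X / \<kappa>)" by simp
  also have "\<dots> \<le> 34 * (\<sigma>\<^sup>2 * ?d * ln X / \<kappa>)"
    using \<open>1 \<le> X\<close> kappa_pos by (intro mult_right_mono) auto
  also have "\<dots> = 34 / \<kappa> * \<sigma>\<^sup>2 * ?d * ln X" by simp
  finally have 1: "3 * \<sigma>\<^sup>2 * (\<Sum>t=1..T. w t) \<le> 34 / \<kappa> * \<sigma>\<^sup>2 * ?d * ln X" .
  define P where "P = K\<^sup>2 * A\<^sup>2 * B\<^sup>2 / \<kappa>"
  define Q where "Q = \<sigma>\<^sup>2 * L / \<kappa>"
  define R where "R = \<kappa> / K\<^sup>2 * \<sigma>\<^sup>2 * L"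
  have "0 \<le> P" "0 \<le> Q" "0 \<le> R" using kappa_pos L by (auto simp: P_def Q_def R_def)
  have "stoc_regret \<phi> x y \<mu>s \<mu>h T
      \<le> 3 / 2 * (lam * B\<^sup>2 + (2 * \<sigma>\<^sup>2 * (\<Sum>t=1..T. w t) + 4 * \<sigma>\<^sup>2 * (\<kappa> / (8 * K\<^sup>2)) * L))
        + \<sigma>\<^sup>2 / (2 * (\<kappa> / 8)) * L / 2"
    by (rule regret_bound[OF lin quad])
  also have "\<dots> = 6 * P + 3 * \<sigma>\<^sup>2 * (\<Sum>t=1..T. w t) + 3 / 4 * R + 2 * Q"
    by (simp add: P_def Q_def R_def lam_eq algebra_simps)
  also have "\<dots> \<le> 8 * P + 34 / \<kappa> * \<sigma>\<^sup>2 * ?d * ln X + (4 * Q + 6 * R)"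
    using 1 \<open>0 \<le> P\<close> \<open>0 \<le> Q\<close> \<open>0 \<le> R\<close> by linarith
  also have "\<dots> = 34 / \<kappa> * \<sigma>\<^sup>2 * ?d * ln X + 8 * K\<^sup>2 * A\<^sup>2 * B\<^sup>2 / \<kappa>
      + 2 * (2 / \<kappa> + 3 * \<kappa> / K\<^sup>2) * \<sigma>\<^sup>2 * L"
    by (simp add: P_def Q_def R_def algebra_simps)
  finally show ?thesis unfolding X_def .
qed

end

section \<open>Measurability of the iterates\<close>

text \<open>Taking the least index makes the choice of an approximate minimiser a countable case
  distinction, hence a measurable selection.\<close>

definition near_argmin :: "(nat \<Rightarrow> 'b) \<Rightarrow> ('b \<Rightarrow> real) \<Rightarrow> real \<Rightarrow> 'b" where
  "near_argmin e f r = e (LEAST k. \<forall>i. f (e k) \<le> f (e i) + r)"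

lemma measurable_near_argmin:
  fixes e :: "nat \<Rightarrow> 'b::topological_space"
  assumes [measurable]: "\<And>k. (\<lambda>\<omega>. f \<omega> (e k)) \<in> borel_measurable N"
  shows "(\<lambda>\<omega>. near_argmin e (f \<omega>) r) \<in> borel_measurable N"
proof -
  have "(\<lambda>\<omega>. LEAST k. \<forall>i. f \<omega> (e k) \<le> f \<omega> (e i) + r) \<in> measurable N (count_space UNIV)"
    by measurable
  from measurable_compose[OF this, of e borel] show ?thesis by (simp add: near_argmin_def)
qed

text \<open>The infimum along \<open>e\<close> need not be attained, but a positive slack
  \<open>r\<close> guarantees a valid index; density and continuity then extend the comparison to
  the whole space.\<close>

lemma near_argmin_le:
  fixes e :: "nat \<Rightarrow> 'b::topological_space"
  assumes dense: "closure (range e) = UNIV" and cont: "continuous_on UNIV f"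
    and bdd: "\<And>v. c \<le> f v" and r: "0 < r"
  shows "f (near_argmin e f r) \<le> f v + r"
proof -
  have bd: "bdd_below (range (\<lambda>i. f (e i)))" using bdd by (intro bdd_belowI[of _ c]) auto
  have "\<exists>k. f (e k) < (INF i. f (e i)) + r"
    using r cINF_less_iff[OF _ bd, of "(INF i. f (e i)) + r"] by auto
  then obtain k where k: "f (e k) < (INF i. f (e i)) + r" by blast
  have "(INF i. f (e i)) \<le> f (e i)" for i using bd by (rule cINF_lower) simp
  then have "\<forall>i. f (e k) \<le> f (e i) + r" using k by (smt (verit))
  then have *: "f (near_argmin e f r) \<le> f (e i) + r" for i
    unfolding near_argmin_def using LeastI[of "\<lambda>k. \<forall>i. f (e k) \<le> f (e i) + r" k] by blast
  have "closed {v. f (near_argmin e f r) \<le> f v + r}"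
    using cont by (intro closed_Collect_le continuous_intros)
  then have "closure (range e) \<subseteq> {v. f (near_argmin e f r) \<le> f v + r}"
    using * by (intro closure_minimal) auto
  then show ?thesis using dense by auto
qed

section \<open>Compact exhaustion and the penalty method\<close>

lemma dense_sequence_exists:
  "\<exists>e :: nat \<Rightarrow> 'b::euclidean_space. closure (range e) = UNIV"
proof -
  obtain D :: "'b set" where D: "countable D" "\<And>X. open X \<Longrightarrow> X \<noteq> {} \<Longrightarrow> \<exists>d\<in>D. d \<in> X"
    using countable_dense_exists by metis
  have "D \<noteq> {}" using D(2)[of UNIV] by auto
  then have "range (from_nat_into D) = D" using D(1) by (rule range_from_nat_into)
  moreover have "closure D = UNIV"
    using D(2)[of "- closure D"] closure_subset[of D] by (auto simp: open_Compl)
  ultimately show ?thesis by metis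
qed

text \<open>\<open>I\<close> may be open, half-open or unbounded, while the penalty argument needs
  compact intervals around the base point 0. These are the hulls of 0 and the first members of a
  countable set that reaches beyond every point of \<open>I\<close> on both sides.\<close>

lemma interval_exhaustion:
  fixes I :: "real set"
  assumes I: "is_interval I" and "0 \<in> I"
  obtains a b :: "nat \<Rightarrow> real" where "\<And>j. 0 \<in> {a j..b j}" "\<And>j. {a j..b j} \<subseteq> I"
    and "\<And>z. z \<in> I \<Longrightarrow> eventually (\<lambda>j. z \<in> {a j..b j}) sequentially"
proof -
  obtain D where D: "countable D" "D \<subseteq> I" "I \<subseteq> closure D"
    using separable by metis
  \<comment> \<open>A dense set can miss a greatest or least element of \<open>I\<close>, so these
    are added where they exist.\<close>
  define U where "U = D \<union> {z\<in>I. \<forall>w\<in>I. w \<le> z} \<union> {z\<in>I. \<forall>w\<in>I. z \<le> w} \<union> {0}"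
  have top: "\<exists>d\<in>U. z \<le> d" if z: "z \<in> I" for z
  proof (cases "\<forall>w\<in>I. w \<le> z")
    case False
    then obtain w where w: "w \<in> I" "z < w" by force
    then obtain d where "d \<in> D" "dist d w < w - z"
      using D(3) closure_approachable[of w D] by (metis diff_gt_0_iff_gt subsetD)
    then show ?thesis unfolding U_def dist_real_def by (intro bexI[of _ d]) auto
  qed (use z in \<open>auto simp: U_def\<close>)
  have bot: "\<exists>d\<in>U. d \<le> z" if z: "z \<in> I" for z
  proof (cases "\<forall>w\<in>I. z \<le> w")
    case False
    then obtain w where w: "w \<in> I" "w < z" by force
    then obtain d where "d \<in> D" "dist d w < z - w"
      using D(3) closure_approachable[of w D] by (metis diff_gt_0_iff_gt subsetD)
    then show ?thesis unfolding U_def dist_real_def by (intro bexI[of _ d]) auto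
  qed (use z in \<open>auto simp: U_def\<close>)
  have fin: "finite E" if "\<And>v w. v \<in> E \<Longrightarrow> w \<in> E \<Longrightarrow> v = w" for E :: "real set"
  proof (cases "E = {}")
    case False
    then obtain v where "v \<in> E" by blast
    then have "E = {v}" using that by blast
    then show ?thesis by simp
  qed simp
  have "finite {z\<in>I. \<forall>w\<in>I. w \<le> z}" "finite {z\<in>I. \<forall>w\<in>I. z \<le> w}"
    by (rule fin, auto simp: order_antisym)+
  then have "countable U" using D(1) by (simp add: U_def countable_finite)
  define u where "u = from_nat_into U"
  have u: "range u = U" unfolding u_def using \<open>countable U\<close> by (intro range_from_nat_into) (auto simp: U_def)
  have UI: "U \<subseteq> I" using D(2) assms(2) by (auto simp: U_def)
  define a where "a j = Min (insert 0 (u ` {..j}))" for j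
  define b where "b j = Max (insert 0 (u ` {..j}))" for j
  have "a j \<in> I" "b j \<in> I" for j
  proof -
    have "insert 0 (u ` {..j}) \<subseteq> I" using u UI assms(2) by auto
    moreover have "a j \<in> insert 0 (u ` {..j})" "b j \<in> insert 0 (u ` {..j})"
      unfolding a_def b_def by (intro Min_in Max_in; simp)+
    ultimately show "a j \<in> I" "b j \<in> I" by blast+
  qed
  then have "{a j..b j} \<subseteq> I" for j by (intro is_interval_segment I)
  moreover have "0 \<in> {a j..b j}" for j by (simp add: a_def b_def)
  moreover have "eventually (\<lambda>j. z \<in> {a j..b j}) sequentially" if z: "z \<in> I" for z
  proof -
    obtain i k where ik: "z \<le> u i" "u k \<le> z" using top[OF z] bot[OF z] u by (metis imageE)
    have "z \<in> {a j..b j}" if "max i k \<le> j" for j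
    proof -
      have "a j \<le> u k" unfolding a_def using that by (intro Min_le) auto
      moreover have "u i \<le> b j" unfolding b_def using that by (intro Max_ge) auto
      ultimately show ?thesis using ik by auto
    qed
    then show ?thesis unfolding eventually_sequentially by blast
  qed
  ultimately show ?thesis using that by blast
qed

text \<open>
  The parameter space cannot be discretised directly, since the feasible set may have empty
  interior. Hence the constraint \<open>x\<^sub>\<tau> \<bullet> \<mu> \<in> {a..b}\<close> is replaced by a penalty, and the
  antiderivative of \<open>\<phi>\<close>, which is only controlled on \<open>{a..b}\<close>, is frozen outside.
\<close>

definition clip :: "real \<Rightarrow> real \<Rightarrow> real \<Rightarrow> real" where
  "clip a b z = max a (min b z)"

definition penalized_obj ::
  "real \<Rightarrow> (real \<Rightarrow> real) \<Rightarrow> real \<Rightarrow> real \<Rightarrow> real \<Rightarrow> (nat \<Rightarrow> real ^ 'd) \<Rightarrow> (nat \<Rightarrow> real) \<Rightarrow> nat \<Rightarrow> real ^ 'd \<Rightarrow> real" where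
  "penalized_obj c \<phi> a b lam x y t \<mu> = lam * (norm \<mu>)\<^sup>2
     + (\<Sum>\<tau>=1..t. antideriv \<phi> (clip a b (x \<tau> \<bullet> \<mu>)) - (x \<tau> \<bullet> \<mu>) * y \<tau>)
     + c * (\<Sum>\<tau>=1..t. \<bar>x \<tau> \<bullet> \<mu> - clip a b (x \<tau> \<bullet> \<mu>)\<bar>)"

lemma clip_mem: "a \<le> b \<Longrightarrow> clip a b z \<in> {a..b}"
  and clip_id: "z \<in> {a..b} \<Longrightarrow> clip a b z = z"
  by (auto simp: clip_def)

lemma continuous_on_clip: "continuous_on S (clip a b)"
  unfolding clip_def by (intro continuous_intros)

lemma continuous_antideriv_clip:
  assumes "continuous_on {a..b} \<phi>" "0 \<in> {a..b}"
  shows "continuous_on S (\<lambda>z. antideriv \<phi> (clip a b z))"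
  using assms(2) clip_mem[of a b]
  by (intro continuous_on_compose2[OF antideriv_continuous[OF assms] continuous_on_clip]) auto

lemma penalized_obj_feasible:
  assumes "\<And>\<tau>. \<tau> \<in> {1..t} \<Longrightarrow> x \<tau> \<bullet> \<mu> \<in> {a..b}"
  shows "penalized_obj c \<phi> a b lam x y t \<mu> = ftrl_obj lam \<phi> x y t \<mu>"
  using assms by (simp add: penalized_obj_def ftrl_obj_def glr_loss_antideriv clip_id)

lemma penalized_obj_zero:
  "penalized_obj c \<phi> a b lam x y t \<mu>
    = penalized_obj 0 \<phi> a b lam x y t \<mu> + c * (\<Sum>\<tau>=1..t. \<bar>x \<tau> \<bullet> \<mu> - clip a b (x \<tau> \<bullet> \<mu>)\<bar>)"
  by (simp add: penalized_obj_def)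

lemma continuous_penalized_obj:
  assumes "continuous_on {a..b} \<phi>" "0 \<in> {a..b}"
  shows "continuous_on UNIV (penalized_obj c \<phi> a b lam x y t)"
proof -
  have "continuous_on UNIV (\<lambda>\<mu>. antideriv \<phi> (clip a b (x \<tau> \<bullet> \<mu>)))" for \<tau>
    by (rule continuous_on_compose2[OF continuous_antideriv_clip[OF assms, of UNIV]])
      (auto intro!: continuous_intros)
  moreover have "continuous_on UNIV (\<lambda>\<mu>. clip a b (x \<tau> \<bullet> \<mu>))" for \<tau>
    by (rule continuous_on_compose2[OF continuous_on_clip[of UNIV]]) (auto intro!: continuous_intros)
  ultimately show ?thesis
    unfolding penalized_obj_def[abs_def] by (intro continuous_intros)
qed

text \<open>Clipping turns the minimum of \<open>antideriv \<phi>\<close> on a compact interval into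
  a global lower bound, and half of the regulariser absorbs the linear label term. Since penalties
  are nonnegative, weight 0 covers all weights.\<close>

lemma penalized_obj_coercive:
  assumes cont: "continuous_on {a..b} \<phi>" "0 \<in> {a..b}" and lam: "0 < lam"
  obtains C where "\<And>\<mu>. lam / 2 * (norm \<mu>)\<^sup>2 + C \<le> penalized_obj 0 \<phi> a b lam x y t \<mu>"
proof -
  have "\<exists>z\<in>{a..b}. \<forall>w\<in>{a..b}. antideriv \<phi> z \<le> antideriv \<phi> w"
    using assms by (intro continuous_attains_inf antideriv_continuous) auto
  then obtain c where c: "\<And>z. z \<in> {a..b} \<Longrightarrow> c \<le> antideriv \<phi> z" by metis
  define g where "g = (\<Sum>\<tau>=1..t. y \<tau> *\<^sub>R x \<tau>)"
  have "lam / 2 * (norm \<mu>)\<^sup>2 + (t * c - (norm g)\<^sup>2 / (2 * lam)) \<le> penalized_obj 0 \<phi> a b lam x y t \<mu>" for \<mu>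
  proof -
    have "(\<Sum>\<tau>=1..t. c) \<le> (\<Sum>\<tau>=1..t. antideriv \<phi> (clip a b (x \<tau> \<bullet> \<mu>)))"
      using assms(2) by (intro sum_mono c clip_mem) auto
    moreover have "(\<Sum>\<tau>=1..t. (x \<tau> \<bullet> \<mu>) * y \<tau>) = g \<bullet> \<mu>"
      unfolding g_def inner_sum_left by (intro sum.cong) auto
    moreover have "g \<bullet> \<mu> \<le> norm g * norm \<mu>" by (rule norm_cauchy_schwarz)
    moreover have "norm g * norm \<mu> \<le> lam / 2 * (norm \<mu>)\<^sup>2 + (norm g)\<^sup>2 / (2 * lam)"
    proof -
      have "0 \<le> (lam * norm \<mu> - norm g)\<^sup>2 / (2 * lam)" using lam by simp
      also have "\<dots> = lam / 2 * (norm \<mu>)\<^sup>2 + (norm g)\<^sup>2 / (2 * lam) - norm g * norm \<mu>"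
        using lam by (simp add: power2_eq_square field_simps)
      finally show ?thesis by simp
    qed
    ultimately show ?thesis by (simp add: penalized_obj_def sum_subtractf)
  qed
  then show ?thesis by (rule that)
qed

text \<open>Coercivity keeps \<open>q\<close> bounded. At a cluster point the penalty vanishes, so
  the point is feasible with objective no larger than the minimum, and the growth at
  \<open>m\<close> forces it to equal \<open>m\<close>. A subsequence staying away from
  \<open>m\<close> would contradict this.\<close>

lemma penalized_minimizers_converge:
  fixes m :: "real ^ 'd"
  assumes act: "activation \<phi> I B \<kappa> K" and sub: "{a..b} \<subseteq> I" "0 \<in> {a..b}" and lam: "0 < lam"
    and min: "\<And>\<nu>. ftrl_obj lam \<phi> x y t m \<le> ftrl_obj lam \<phi> x y t \<nu>"
    and m: "\<And>\<tau>. \<tau> \<in> {1..t} \<Longrightarrow> x \<tau> \<bullet> m \<in> {a..b}"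
    and q: "\<And>n. penalized_obj (real n) \<phi> a b lam x y t (q n)
      \<le> penalized_obj (real n) \<phi> a b lam x y t m + 1 / real (Suc n)"
  shows "q \<longlonglongrightarrow> m"
proof (rule ccontr)
  let ?f = "penalized_obj 0 \<phi> a b lam x y t" and ?m = "ftrl_obj lam \<phi> x y t m"
  let ?pen = "\<lambda>\<mu>. \<Sum>\<tau>=1..t. \<bar>x \<tau> \<bullet> \<mu> - clip a b (x \<tau> \<bullet> \<mu>)\<bar>"
  have cont: "continuous_on {a..b} \<phi>"
    using activation_continuous[OF act] sub(1) continuous_on_subset by blast
  obtain C where C: "\<And>\<mu>. lam / 2 * (norm \<mu>)\<^sup>2 + C \<le> ?f \<mu>"
    using penalized_obj_coercive[OF cont sub(2) lam] by metis
  have q': "?f (q n) + real n * ?pen (q n) \<le> ?m + 1 / real (Suc n)" for n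
  proof -
    have "penalized_obj (real n) \<phi> a b lam x y t m = ?m" by (rule penalized_obj_feasible[OF m])
    with q[of n] show ?thesis unfolding penalized_obj_zero[of "real n" \<phi> a b lam x y t "q n"] by simp
  qed
  have pen0: "0 \<le> real n * ?pen \<mu>" for n \<mu> by (intro mult_nonneg_nonneg sum_nonneg) auto
  have inv1: "1 / real (Suc n) \<le> 1" for n by simp
  have "norm (q n) \<le> sqrt (2 / lam * (?m + 1 - C))" for n
  proof (rule real_le_rsqrt)
    have "lam / 2 * (norm (q n))\<^sup>2 \<le> ?m + 1 - C"
      using q'[of n] pen0[of n "q n"] inv1[of n] C[of "q n"] by linarith
    then show "(norm (q n))\<^sup>2 \<le> 2 / lam * (?m + 1 - C)" using lam by (simp add: field_simps)
  qed
  then have bdd: "q n \<in> cball 0 (sqrt (2 / lam * (?m + 1 - C)))" for n by simp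
  assume "\<not> q \<longlonglongrightarrow> m"
  then obtain e where e: "0 < e" "\<not> eventually (\<lambda>n. dist (q n) m < e) sequentially"
    unfolding tendsto_iff by blast
  then obtain r :: "nat \<Rightarrow> nat" where r: "strict_mono r" "\<And>n. \<not> dist (q (r n)) m < e"
    using not_eventually_sequentiallyD by metis
  obtain l s where s: "strict_mono (s :: nat \<Rightarrow> nat)" and l: "(\<lambda>n. q (r (s n))) \<longlonglongrightarrow> l"
    using seq_compactE[OF compact_imp_seq_compact[OF compact_cball], of "\<lambda>n. q (r n)", OF allI[OF bdd]]
    unfolding o_def by blast
  define p where "p n = r (s n)" for n
  have p: "filterlim p at_top sequentially"
    unfolding p_def using r(1) s filterlim_subseq strict_mono_compose by blast
  have lp: "(\<lambda>n. q (p n)) \<longlonglongrightarrow> l" using l by (simp add: p_def)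
  have inv: "(\<lambda>n. 1 / real (Suc (p n))) \<longlonglongrightarrow> 0"
    using filterlim_compose[OF LIMSEQ_inverse_real_of_nat p] by (simp add: inverse_eq_divide)
  have "continuous_on UNIV ?pen"
  proof -
    have "continuous_on UNIV (\<lambda>\<mu>. clip a b (x \<tau> \<bullet> \<mu>))" for \<tau>
      by (rule continuous_on_compose2[OF continuous_on_clip[of UNIV]]) (auto intro!: continuous_intros)
    then show ?thesis by (intro continuous_intros)
  qed
  then have pen_lim: "(\<lambda>n. ?pen (q (p n))) \<longlonglongrightarrow> ?pen l"
    using lp by (intro continuous_on_tendsto_compose[where s=UNIV and f="?pen"]) auto
  \<comment> \<open>The weighted penalty is bounded, so the penalty decays like the inverse weight;
    the factor 2 pays for passing from \<open>p n\<close> to \<open>Suc (p n)\<close>.\<close>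
  have pen_le: "?pen (q (p n)) \<le> 2 * (?m + 1 - C) * (1 / real (Suc (p n)))" if "1 \<le> p n" for n
  proof -
    define P where "P = ?pen (q (p n))"
    have "0 \<le> P" unfolding P_def by (intro sum_nonneg) auto
    have "0 \<le> lam / 2 * (norm (q (p n)))\<^sup>2" using lam by simp
    then have "real (p n) * P \<le> ?m + 1 - C"
      using q'[of "p n"] inv1[of "p n"] C[of "q (p n)"] unfolding P_def by linarith
    moreover have "real (Suc (p n)) * P \<le> (2 * real (p n)) * P"
      using that \<open>0 \<le> P\<close> by (intro mult_right_mono) auto
    ultimately have "real (Suc (p n)) * P \<le> 2 * (?m + 1 - C)" by argo
    then have "P \<le> 2 * (?m + 1 - C) / real (Suc (p n))"
      by (subst pos_le_divide_eq) (simp_all only: of_nat_0_less_iff zero_less_Suc mult.commute)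
    then show ?thesis by (simp only: P_def times_divide_eq_right mult_1_right)
  qed
  have "eventually (\<lambda>n. 1 \<le> p n) sequentially"
    using p unfolding filterlim_at_top by blast
  then have pen_ev: "eventually (\<lambda>n. ?pen (q (p n)) \<le> 2 * (?m + 1 - C) * (1 / real (Suc (p n)))) sequentially"
    by eventually_elim (rule pen_le)
  have "(\<lambda>n. 2 * (?m + 1 - C) * (1 / real (Suc (p n)))) \<longlonglongrightarrow> 2 * (?m + 1 - C) * 0"
    by (intro tendsto_mult_left inv)
  from tendsto_le[OF sequentially_bot this pen_lim pen_ev] have "?pen l \<le> 0" by simp
  moreover have "0 \<le> ?pen l" by (intro sum_nonneg) auto
  ultimately have "?pen l = 0" by (rule antisym)
  then have l_eq: "x \<tau> \<bullet> l = clip a b (x \<tau> \<bullet> l)" if "\<tau> \<in> {1..t}" for \<tau>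
    using that by (subst (asm) sum_nonneg_eq_0_iff) auto
  have l_in: "x \<tau> \<bullet> l \<in> {a..b}" if "\<tau> \<in> {1..t}" for \<tau>
    using sub(2) by (subst l_eq[OF that], intro clip_mem) auto
  have "(\<lambda>n. ?f (q (p n))) \<longlonglongrightarrow> ?f l"
    using lp continuous_penalized_obj[OF cont sub(2)]
    by (intro continuous_on_tendsto_compose[where s=UNIV and f="?f"]) auto
  moreover have "(\<lambda>n. ?m + 1 / real (Suc (p n))) \<longlonglongrightarrow> ?m + 0"
    by (intro tendsto_add tendsto_const inv)
  moreover have "?f (q (p n)) \<le> ?m + 1 / real (Suc (p n))" for n
    using q'[of "p n"] pen0[of "p n" "q (p n)"] by linarith
  ultimately have "?f l \<le> ?m + 0" by (intro LIMSEQ_le) auto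
  moreover have "?f l = ftrl_obj lam \<phi> x y t l" using l_in by (rule penalized_obj_feasible)
  moreover have "?m + (lam * (norm (l - m))\<^sup>2 + \<kappa> / 2 * (\<Sum>\<tau>=1..t. (x \<tau> \<bullet> (l - m))\<^sup>2))
      \<le> ftrl_obj lam \<phi> x y t l"
    using m l_in sub by (intro ftrl_minimizer_growth[OF act _ min]) auto
  moreover have "0 \<le> \<kappa> / 2 * (\<Sum>\<tau>=1..t. (x \<tau> \<bullet> (l - m))\<^sup>2)"
    using activation_pos[OF act] by (intro mult_nonneg_nonneg sum_nonneg) auto
  ultimately have "lam * (norm (l - m))\<^sup>2 \<le> 0" by linarith
  then have "l = m" using lam by (simp add: mult_le_0_iff)
  then have "eventually (\<lambda>n. dist (q (p n)) m < e) sequentially"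
    using lp e(1) by (simp add: tendsto_iff)
  then show False using r(2) by (auto simp: p_def)
qed

text \<open>Two nested limits are needed: the inner one drives the penalty weight to infinity on a
  fixed compact interval, the outer one enlarges the interval, because the one containing the
  arguments depends on the outcome.\<close>

lemma ftrl_minimizer_measurable:
  fixes m :: "'w \<Rightarrow> real ^ 'd"
  assumes act: "activation \<phi> I B \<kappa> K" and zero: "0 \<in> I" and lam: "0 < lam"
    and x: "\<And>\<tau>. \<tau> \<in> {1..t} \<Longrightarrow> x \<tau> \<in> borel_measurable N"
    and y: "\<And>\<tau>. \<tau> \<in> {1..t} \<Longrightarrow> y \<tau> \<in> borel_measurable N"
    and min: "\<And>\<omega> \<nu>. \<omega> \<in> space N \<Longrightarrow> ftrl_obj lam \<phi> (\<lambda>\<tau>. x \<tau> \<omega>) (\<lambda>\<tau>. y \<tau> \<omega>) t (m \<omega>)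
      \<le> ftrl_obj lam \<phi> (\<lambda>\<tau>. x \<tau> \<omega>) (\<lambda>\<tau>. y \<tau> \<omega>) t \<nu>"
    and args: "\<And>\<omega> \<tau>. \<omega> \<in> space N \<Longrightarrow> \<tau> \<in> {1..t} \<Longrightarrow> x \<tau> \<omega> \<bullet> m \<omega> \<in> I"
  shows "m \<in> borel_measurable N"
proof -
  obtain a b :: "nat \<Rightarrow> real" where ab: "\<And>j. 0 \<in> {a j..b j}" "\<And>j. {a j..b j} \<subseteq> I"
    and ex: "\<And>z. z \<in> I \<Longrightarrow> eventually (\<lambda>j. z \<in> {a j..b j}) sequentially"
    using interval_exhaustion[OF activation_interval[OF act] zero] by blast
  obtain e :: "nat \<Rightarrow> real ^ 'd" where e: "closure (range e) = UNIV"
    using dense_sequence_exists by blast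
  define J where "J j n \<omega> = penalized_obj (real n) \<phi> (a j) (b j) lam (\<lambda>\<tau>. x \<tau> \<omega>) (\<lambda>\<tau>. y \<tau> \<omega>) t" for j n \<omega>
  define q where "q j n \<omega> = near_argmin e (J j n \<omega>) (1 / real (Suc n))" for j n \<omega>
  have cont: "continuous_on {a j..b j} \<phi>" for j
    using activation_continuous[OF act] ab(2) continuous_on_subset by blast
  have [measurable]: "q j n \<in> borel_measurable N" for j n
    unfolding q_def[abs_def]
  proof (rule measurable_near_argmin)
    fix k
    have [measurable]: "(\<lambda>z. antideriv \<phi> (clip (a j) (b j) z)) \<in> borel_measurable borel"
      "clip (a j) (b j) \<in> borel_measurable borel"
      by (intro borel_measurable_continuous_onI continuous_antideriv_clip cont ab continuous_on_clip)+
    have "(\<lambda>\<omega>. antideriv \<phi> (clip (a j) (b j) (x \<tau> \<omega> \<bullet> e k)) - (x \<tau> \<omega> \<bullet> e k) * y \<tau> \<omega>) \<in> borel_measurable N"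
      "(\<lambda>\<omega>. \<bar>x \<tau> \<omega> \<bullet> e k - clip (a j) (b j) (x \<tau> \<omega> \<bullet> e k)\<bar>) \<in> borel_measurable N" if "\<tau> \<in> {1..t}" for \<tau>
      using x[OF that] y[OF that] by measurable
    then show "(\<lambda>\<omega>. J j n \<omega> (e k)) \<in> borel_measurable N"
      unfolding J_def penalized_obj_def by measurable
  qed
  have "lim (\<lambda>j. lim (\<lambda>n. q j n \<omega>)) = m \<omega>" if \<omega>: "\<omega> \<in> space N" for \<omega>
  proof -
    have "eventually (\<lambda>j. \<forall>\<tau>\<in>{1..t}. x \<tau> \<omega> \<bullet> m \<omega> \<in> {a j..b j}) sequentially"
      using ex args[OF \<omega>] by (intro eventually_ball_finite) auto
    \<comment> \<open>For small \<open>j\<close> an argument may lie outside the interval and the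
      inner \<open>lim\<close> may be an unrelated value; only late \<open>j\<close> affect the
      outer limit.\<close>
    then have "eventually (\<lambda>j. lim (\<lambda>n. q j n \<omega>) = m \<omega>) sequentially"
    proof eventually_elim
      case (elim j)
      obtain C where C: "\<And>\<mu>. lam / 2 * (norm \<mu>)\<^sup>2 + C \<le> J j 0 \<omega> \<mu>"
        using penalized_obj_coercive[OF cont ab(1) lam] unfolding J_def of_nat_0 by metis
      have "C \<le> J j n \<omega> \<mu>" for n \<mu>
      proof -
        have "J j 0 \<omega> \<mu> \<le> J j n \<omega> \<mu>"
          unfolding J_def of_nat_0 penalized_obj_zero[of "real n"] by (simp add: sum_nonneg)
        moreover have "C \<le> lam / 2 * (norm \<mu>)\<^sup>2 + C" using lam by simp
        ultimately show ?thesis using C[of \<mu>] by linarith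
      qed
      moreover have "continuous_on UNIV (J j n \<omega>)" for n
        unfolding J_def by (rule continuous_penalized_obj[OF cont ab(1)])
      ultimately have "J j n \<omega> (q j n \<omega>) \<le> J j n \<omega> (m \<omega>) + 1 / real (Suc n)" for n
        unfolding q_def by (intro near_argmin_le[OF e]) auto
      then have "(\<lambda>n. q j n \<omega>) \<longlonglongrightarrow> m \<omega>"
        using elim unfolding J_def
        by (intro penalized_minimizers_converge[OF act ab(2,1) lam min[OF \<omega>]]) auto
      then show ?case by (rule limI)
    qed
    then have "(\<lambda>j. lim (\<lambda>n. q j n \<omega>)) \<longlonglongrightarrow> m \<omega>" by (rule tendsto_eventually)
    then show ?thesis by (rule limI)
  qed
  then have "(\<lambda>\<omega>. lim (\<lambda>j. lim (\<lambda>n. q j n \<omega>))) \<in> borel_measurable N \<longleftrightarrow> m \<in> borel_measurable N"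
    by (rule measurable_cong)
  moreover have "(\<lambda>\<omega>. lim (\<lambda>j. lim (\<lambda>n. q j n \<omega>))) \<in> borel_measurable N" by measurable
  ultimately show ?thesis by blast
qed

text \<open>Off \<open>I\<close> not even measurability of \<open>\<phi>\<close> is known; the
  indicator cuts that part away without changing the values along \<open>f\<close>.\<close>

lemma measurable_compose_interval:
  fixes \<phi> f :: "_ \<Rightarrow> real"
  assumes "is_interval I" "continuous_on I \<phi>" and [measurable]: "f \<in> borel_measurable N"
    and f: "\<And>\<omega>. \<omega> \<in> space N \<Longrightarrow> f \<omega> \<in> I"
  shows "(\<lambda>\<omega>. \<phi> (f \<omega>)) \<in> borel_measurable N"
proof -
  have [measurable]: "(\<lambda>z. indicator I z *\<^sub>R \<phi> z) \<in> borel_measurable borel"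
    using assms(1,2) by (intro borel_measurable_continuous_on_indicator real_interval_borel_measurable)
  have "(\<lambda>\<omega>. indicator I (f \<omega>) *\<^sub>R \<phi> (f \<omega>)) \<in> borel_measurable N" by measurable
  then show ?thesis using f by (subst (asm) measurable_cong[of N _ "\<lambda>\<omega>. \<phi> (f \<omega>)"]) auto
qed

text \<open>A convergent sequence together with its limit and 0 is compact, so it lies in a compact
  subinterval of \<open>I\<close>, where continuity is known.\<close>

lemma continuous_on_antideriv_interval:
  assumes I: "is_interval I" "0 \<in> I" and cont: "continuous_on I \<phi>"
  shows "continuous_on I (antideriv \<phi>)"
  unfolding continuous_on_sequentially
proof (intro allI ballI impI)
  fix X :: "nat \<Rightarrow> real" and z
  assume z: "z \<in> I" and X: "(\<forall>n. X n \<in> I) \<and> X \<longlonglongrightarrow> z"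
  then have "compact (insert z (range X))" by (intro compact_sequence_with_limit) auto
  define S where "S = insert 0 (insert z (range X))"
  have S: "compact S" "S \<noteq> {}" "S \<subseteq> I"
    using \<open>compact (insert z (range X))\<close> X z I(2) unfolding S_def by (auto intro: compact_insert)
  obtain a b where ab: "a \<in> S" "b \<in> S" "\<And>s. s \<in> S \<Longrightarrow> a \<le> s" "\<And>s. s \<in> S \<Longrightarrow> s \<le> b"
    using compact_attains_inf[OF S(1,2)] compact_attains_sup[OF S(1,2)] by metis
  have sub: "{a..b} \<subseteq> I" using ab S I by (intro is_interval_segment) auto
  have "continuous_on {a..b} (antideriv \<phi>)"
    using continuous_on_subset[OF cont sub] ab(3,4) by (intro antideriv_continuous) (auto simp: S_def)
  then show "(antideriv \<phi> \<circ> X) \<longlonglongrightarrow> antideriv \<phi> z"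
    unfolding continuous_on_sequentially using ab(3,4) X by (auto simp: S_def)
qed

lemma measurable_det_gram:
  assumes "\<And>\<tau>. \<tau> \<in> {1..t} \<Longrightarrow> x \<tau> \<in> borel_measurable N"
  shows "(\<lambda>\<omega>. det (gram a k (\<lambda>\<tau>. x \<tau> \<omega> :: real ^ 'd) t)) \<in> borel_measurable N"
proof -
  have "(\<lambda>\<omega>. x \<tau> \<omega> $ i) \<in> borel_measurable N" if "\<tau> \<in> {1..t}" for \<tau> and i :: 'd
    by (rule measurable_compose[OF assms[OF that]])
      (intro borel_measurable_continuous_onI continuous_intros)
  then have [measurable]: "(\<lambda>\<omega>. gram a k (\<lambda>\<tau>. x \<tau> \<omega>) t $ i $ j) \<in> borel_measurable N" for i j :: 'd
    unfolding gram_def by simp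
  show ?thesis unfolding det_def by measurable
qed

lemma measurable_width:
  assumes "\<And>\<tau>. \<tau> \<in> {1..t} \<Longrightarrow> x \<tau> \<in> borel_measurable N"
  shows "(\<lambda>\<omega>. width a k (\<lambda>\<tau>. x \<tau> \<omega> :: real ^ 'd) t) \<in> borel_measurable N"
proof -
  have [measurable]: "(\<lambda>\<omega>. det (gram a k (\<lambda>\<tau>. x \<tau> \<omega>) t)) \<in> borel_measurable N"
    "(\<lambda>\<omega>. det (gram a k (\<lambda>\<tau>. x \<tau> \<omega>) (t - 1))) \<in> borel_measurable N"
    using assms by (auto intro!: measurable_det_gram)
  show ?thesis unfolding width_def by measurable
qed

section \<open>Concentration\<close>

lemma nn_integral_normal_density:
  assumes "0 < s"
  shows "(\<integral>\<^sup>+z. ennreal (normal_density m s z) \<partial>lborel) = 1"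
  using assms by (subst nn_integral_eq_integral) auto

lemma std_normal_exp_linear:
  "(\<integral>\<^sup>+z. ennreal (std_normal_density z * exp (c * z)) \<partial>lborel) = ennreal (exp (c\<^sup>2 / 2))"
proof -
  have "std_normal_density z * exp (c * z) = exp (c\<^sup>2 / 2) * normal_density c 1 z" for z
    unfolding normal_density_def
    by (simp add: exp_add[symmetric] power2_eq_square field_simps)
  then have "(\<integral>\<^sup>+z. ennreal (std_normal_density z * exp (c * z)) \<partial>lborel)
      = (\<integral>\<^sup>+z. ennreal (exp (c\<^sup>2 / 2)) * ennreal (normal_density c 1 z) \<partial>lborel)"
    by (simp add: ennreal_mult)
  then show ?thesis by (simp add: nn_integral_cmult nn_integral_normal_density)
qed

text \<open>Tilting by the square gives a multiple of the centred normal density with variance 1/(1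
  - b); \<open>b < 1\<close> keeps that variance finite and positive.\<close>

lemma std_normal_exp_square:
  assumes "b < 1"
  shows "(\<integral>\<^sup>+z. ennreal (std_normal_density z * exp (b * z\<^sup>2 / 2)) \<partial>lborel) = ennreal (1 / sqrt (1 - b))"
proof -
  have v: "0 < 1 - b" using assms by simp
  have "std_normal_density z * exp (b * z\<^sup>2 / 2) = 1 / sqrt (1 - b) * normal_density 0 (1 / sqrt (1 - b)) z" for z
  proof -
    have "- z\<^sup>2 / 2 + b * z\<^sup>2 / 2 = - z\<^sup>2 / (2 * (1 / sqrt (1 - b))\<^sup>2)"
      using v by (simp add: power_divide field_simps)
    moreover have "1 / sqrt (1 - b) * (1 / sqrt (2 * pi * (1 / sqrt (1 - b))\<^sup>2)) = 1 / sqrt (2 * pi)"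
      using v by (simp add: power_divide real_sqrt_divide real_sqrt_mult)
    ultimately show ?thesis
      unfolding normal_density_def by (simp add: exp_add[symmetric] mult.assoc[symmetric])
  qed
  then have "(\<integral>\<^sup>+z. ennreal (std_normal_density z * exp (b * z\<^sup>2 / 2)) \<partial>lborel)
      = (\<integral>\<^sup>+z. ennreal (1 / sqrt (1 - b)) * ennreal (normal_density 0 (1 / sqrt (1 - b)) z) \<partial>lborel)"
    using v by (subst ennreal_mult[symmetric]) auto
  then show ?thesis using v by (simp add: nn_integral_cmult nn_integral_normal_density)
qed

lemma subgaussian_nn_integral:
  assumes "subgaussian M \<sigma> X"
  shows "(\<integral>\<^sup>+\<omega>. ennreal (exp (s * X \<omega>)) \<partial>M) \<le> ennreal (exp (\<sigma>\<^sup>2 * s\<^sup>2 / 2))"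
  using assms unfolding subgaussian_def
  by (subst nn_integral_eq_integral) (auto intro: ennreal_leI)

text \<open>
  The square in the exponent is linearised by averaging \<open>exp (sqrt (2 * c) * z * X)\<close> over an
  auxiliary standard normal variable \<open>z\<close>.
\<close>

lemma (in prob_space) subgaussian_square:
  assumes sub: "subgaussian M \<sigma> X" and [measurable]: "X \<in> borel_measurable M"
    and c: "0 \<le> c" "2 * c * \<sigma>\<^sup>2 \<le> 1 / 2"
  shows "(\<integral>\<^sup>+\<omega>. ennreal (exp (c * (X \<omega>)\<^sup>2)) \<partial>M) \<le> ennreal (exp (2 * c * \<sigma>\<^sup>2))"
proof -
  define b where "b = 2 * c * \<sigma>\<^sup>2"
  have b: "0 \<le> b" "b \<le> 1 / 2" using c by (auto simp: b_def)
  interpret P: pair_sigma_finite M lborel ..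
  have "(\<integral>\<^sup>+\<omega>. ennreal (exp (c * (X \<omega>)\<^sup>2)) \<partial>M)
      = (\<integral>\<^sup>+\<omega>. (\<integral>\<^sup>+z. ennreal (std_normal_density z * exp ((sqrt (2 * c) * X \<omega>) * z)) \<partial>lborel) \<partial>M)"
    unfolding std_normal_exp_linear using c by (simp add: power_mult_distrib)
  also have "\<dots> = (\<integral>\<^sup>+z. (\<integral>\<^sup>+\<omega>. ennreal (std_normal_density z * exp ((sqrt (2 * c) * X \<omega>) * z)) \<partial>M) \<partial>lborel)"
    by (rule P.Fubini'[symmetric]) measurable
  also have "\<dots> \<le> (\<integral>\<^sup>+z. ennreal (std_normal_density z * exp (b * z\<^sup>2 / 2)) \<partial>lborel)"
  proof (rule nn_integral_mono)
    fix z :: real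
    have "(\<integral>\<^sup>+\<omega>. ennreal (std_normal_density z * exp ((sqrt (2 * c) * X \<omega>) * z)) \<partial>M)
        = ennreal (std_normal_density z) * (\<integral>\<^sup>+\<omega>. ennreal (exp ((sqrt (2 * c) * z) * X \<omega>)) \<partial>M)"
      by (subst nn_integral_cmult[symmetric]) (auto simp: ennreal_mult mult_ac)
    also have "\<dots> \<le> ennreal (std_normal_density z) * ennreal (exp (\<sigma>\<^sup>2 * (sqrt (2 * c) * z)\<^sup>2 / 2))"
      by (intro mult_left_mono subgaussian_nn_integral[OF sub]) auto
    also have "\<dots> = ennreal (std_normal_density z * exp (b * z\<^sup>2 / 2))"
      using c by (simp add: ennreal_mult power_mult_distrib b_def mult_ac)
    finally show "(\<integral>\<^sup>+\<omega>. ennreal (std_normal_density z * exp ((sqrt (2 * c) * X \<omega>) * z)) \<partial>M)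
        \<le> ennreal (std_normal_density z * exp (b * z\<^sup>2 / 2))" .
  qed
  also have "\<dots> = ennreal (1 / sqrt (1 - b))" using b by (intro std_normal_exp_square) auto
  also have "\<dots> \<le> ennreal (exp b)"
  proof (rule ennreal_leI)
    \<comment> \<open>Equivalent to \<open>0 \<le> b * (1 - 2 * b)\<close>, which is where the
      restriction to \<open>b \<le> 1 / 2\<close> enters.\<close>
    have "1 \<le> (1 - b) * (1 + 2 * b)" using mult_nonneg_nonneg[of b "1 - 2 * b"] b by (simp add: algebra_simps)
    also have "\<dots> \<le> (1 - b) * exp (2 * b)" using b exp_ge_add_one_self[of "2 * b"] by (intro mult_left_mono) auto
    also have "\<dots> = (exp b)\<^sup>2 * (1 - b)" by (simp add: exp_double)
    finally have "sqrt 1 \<le> sqrt ((exp b)\<^sup>2 * (1 - b))" by (simp only: real_sqrt_le_iff)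
    then have "1 \<le> exp b * sqrt (1 - b)" by (simp add: real_sqrt_mult)
    then show "1 / sqrt (1 - b) \<le> exp b" using b by (simp add: field_simps)
  qed
  finally show ?thesis by (simp add: b_def)
qed

text \<open>The scale factors in the tail bounds divide by \<open>\<sigma>\<^sup>2\<close>, so
  \<open>\<sigma> = 0\<close> is treated apart. Then exp(X^2) has mean at most 1 while dominating 1
  + X^2.\<close>

lemma (in prob_space) subgaussian_zero_AE:
  assumes sub: "subgaussian M 0 X" and [measurable]: "X \<in> borel_measurable M"
  shows "AE \<omega> in M. X \<omega> = 0"
proof -
  have "(\<integral>\<^sup>+\<omega>. ennreal (1 + (X \<omega>)\<^sup>2) \<partial>M) \<le> (\<integral>\<^sup>+\<omega>. ennreal (exp (1 * (X \<omega>)\<^sup>2)) \<partial>M)"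
    by (intro nn_integral_mono ennreal_leI) (simp add: exp_ge_add_one_self)
  also have "\<dots> \<le> 1" using subgaussian_square[OF sub, of 1] by simp
  finally have "1 + (\<integral>\<^sup>+\<omega>. ennreal ((X \<omega>)\<^sup>2) \<partial>M) \<le> 1 + 0"
    by (simp add: nn_integral_add emeasure_space_1)
  then have "(\<integral>\<^sup>+\<omega>. ennreal ((X \<omega>)\<^sup>2) \<partial>M) = 0"
    by (subst (asm) ennreal_add_left_cancel_le) auto
  then have "AE \<omega> in M. ennreal ((X \<omega>)\<^sup>2) = 0"
    by (subst (asm) nn_integral_0_iff_AE) auto
  then show ?thesis by eventually_elim simp
qed

text \<open>One supermartingale step without conditional expectations: the past
  \<open>(Z, a)\<close> and the fresh \<open>Y\<close> have a product law, so \<open>Y\<close> can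
  be integrated out first with \<open>a\<close> frozen.\<close>

lemma (in prob_space) nn_integral_indep_set_le:
  fixes Z :: "'a \<Rightarrow> ennreal" and a Y :: "'a \<Rightarrow> real" and g :: "real \<Rightarrow> real \<Rightarrow> ennreal"
  assumes G: "subalgebra M G" and [measurable]: "Z \<in> borel_measurable G" "a \<in> borel_measurable G"
    and Y [measurable]: "Y \<in> borel_measurable M"
    and indep: "indep_set (sets G) (sets (vimage_algebra (space M) Y borel))"
    and g [measurable]: "(\<lambda>p. g (fst p) (snd p)) \<in> borel_measurable (borel \<Otimes>\<^sub>M borel)"
    and le: "\<And>\<omega>. \<omega> \<in> space M \<Longrightarrow> (\<integral>\<^sup>+\<omega>'. g (a \<omega>) (Y \<omega>') \<partial>M) \<le> 1"
  shows "(\<integral>\<^sup>+\<omega>. Z \<omega> * g (a \<omega>) (Y \<omega>) \<partial>M) \<le> (\<integral>\<^sup>+\<omega>. Z \<omega> \<partial>M)"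
    (is "?lhs \<le> _")
proof -
  let ?S = "borel \<Otimes>\<^sub>M borel :: (ennreal \<times> real) measure"
  let ?GY = "vimage_algebra (space M) Y borel"
  define W where "W = (\<lambda>\<omega>. (Z \<omega>, a \<omega>))"
  \<comment> \<open>The dummy component gives \<open>V\<close> the same codomain as
    \<open>W\<close>, as \<open>indep_var\<close> demands of its two variables.\<close>
  define V where "V = (\<lambda>\<omega>. (0 :: ennreal, Y \<omega>))"
  have WG: "W \<in> measurable G ?S" unfolding W_def by measurable
  then have W [measurable]: "W \<in> measurable M ?S" by (rule measurable_from_subalg[OF G])
  have V [measurable]: "V \<in> measurable M ?S" unfolding V_def by measurable
  have Y': "Y \<in> borel_measurable ?GY" by (rule measurable_vimage_algebra1) simp
  have VG: "V \<in> measurable ?GY ?S"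
    unfolding V_def by (rule measurable_Pair[OF _ Y']) simp
  have gen: "sigma_sets (space M) {f -` A \<inter> space M |A. A \<in> sets ?S} \<subseteq> sets H"
    if "f \<in> measurable H ?S" and sp: "space H = space M" for f H
  proof -
    have "{f -` A \<inter> space M |A. A \<in> sets ?S} \<subseteq> sets H"
      using measurable_sets[OF that(1)] sp by auto
    then show ?thesis
      using sets.sigma_sets_subset[of "{f -` A \<inter> space M |A. A \<in> sets ?S}" H] unfolding sp by simp
  qed
  have "indep_set (sigma_sets (space M) {W -` A \<inter> space M |A. A \<in> sets ?S})
      (sigma_sets (space M) {V -` A \<inter> space M |A. A \<in> sets ?S})"
    unfolding indep_set_def
    by (rule indep_sets_mono_sets[OF indep[unfolded indep_set_def]])
      (use gen[OF WG] gen[OF VG] G in \<open>simp add: subalgebra_def split: bool.split\<close>)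
  then have "indep_var ?S W ?S V"
    unfolding indep_var_eq by (auto simp: W V)
  then have prod: "distr M ?S W \<Otimes>\<^sub>M distr M ?S V = distr M (?S \<Otimes>\<^sub>M ?S) (\<lambda>\<omega>. (W \<omega>, V \<omega>))"
    unfolding indep_var_distribution_eq by blast
  interpret D: prob_space "distr M ?S V" by (rule prob_space_distr) measurable
  let ?f = "\<lambda>p :: (ennreal \<times> real) \<times> (ennreal \<times> real). fst (fst p) * g (snd (fst p)) (snd (snd p))"
  have gg [measurable]: "(\<lambda>p :: (ennreal \<times> real) \<times> (ennreal \<times> real). g (snd (fst p)) (snd (snd p)))
      \<in> borel_measurable (?S \<Otimes>\<^sub>M ?S)"
    using measurable_compose[OF _ g,
        of "\<lambda>p :: (ennreal \<times> real) \<times> (ennreal \<times> real). (snd (fst p), snd (snd p))" "?S \<Otimes>\<^sub>M ?S"]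
    by simp
  have f [measurable]: "?f \<in> borel_measurable (?S \<Otimes>\<^sub>M ?S)" by measurable
  have "?lhs = (\<integral>\<^sup>+\<omega>. ?f (W \<omega>, V \<omega>) \<partial>M)" by (simp add: W_def V_def)
  also have "\<dots> = (\<integral>\<^sup>+p. ?f p \<partial>distr M (?S \<Otimes>\<^sub>M ?S) (\<lambda>\<omega>. (W \<omega>, V \<omega>)))"
    by (rule nn_integral_distr[symmetric]) measurable
  also have "\<dots> = (\<integral>\<^sup>+w. (\<integral>\<^sup>+v. ?f (w, v) \<partial>distr M ?S V) \<partial>distr M ?S W)"
    unfolding prod[symmetric] by (rule D.nn_integral_fst[symmetric]) (simp add: f)
  also have "\<dots> = (\<integral>\<^sup>+\<omega>. (\<integral>\<^sup>+v. ?f (W \<omega>, v) \<partial>distr M ?S V) \<partial>M)"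
    by (rule nn_integral_distr[OF W]) (intro D.borel_measurable_nn_integral, simp add: f)
  also have "\<dots> = (\<integral>\<^sup>+\<omega>. (\<integral>\<^sup>+\<omega>'. ?f (W \<omega>, V \<omega>') \<partial>M) \<partial>M)"
  proof (rule nn_integral_cong, rule nn_integral_distr[OF V])
    fix \<omega> assume "\<omega> \<in> space M"
    have [measurable]: "(\<lambda>v :: ennreal \<times> real. g (snd (W \<omega>)) (snd v)) \<in> borel_measurable ?S"
      using measurable_compose[OF _ g, of "\<lambda>v :: ennreal \<times> real. (snd (W \<omega>), snd v)" ?S] by simp
    show "(\<lambda>v. ?f (W \<omega>, v)) \<in> borel_measurable (distr M ?S V)" by simp
  qed
  also have "\<dots> \<le> (\<integral>\<^sup>+\<omega>. Z \<omega> \<partial>M)"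
  proof (rule nn_integral_mono)
    fix \<omega> assume \<omega>: "\<omega> \<in> space M"
    have [measurable]: "(\<lambda>\<omega>'. g (a \<omega>) (Y \<omega>')) \<in> borel_measurable M"
      using measurable_compose[OF _ g, of "\<lambda>\<omega>'. (a \<omega>, Y \<omega>')" M] by simp
    have "(\<integral>\<^sup>+\<omega>'. ?f (W \<omega>, V \<omega>') \<partial>M) = Z \<omega> * (\<integral>\<^sup>+\<omega>'. g (a \<omega>) (Y \<omega>') \<partial>M)"
      unfolding W_def V_def by (simp add: nn_integral_cmult)
    also have "\<dots> \<le> Z \<omega> * 1" by (intro mult_left_mono le[OF \<omega>]) auto
    finally show "(\<integral>\<^sup>+\<omega>'. ?f (W \<omega>, V \<omega>') \<partial>M) \<le> Z \<omega>" by simp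
  qed
  finally show ?thesis .
qed

section \<open>Exponential supermartingales for adapted noise\<close>

locale noise_process = prob_space M for M :: "'a measure" +
  fixes F :: "nat \<Rightarrow> 'a measure" and T :: nat and \<epsilon> :: "nat \<Rightarrow> 'a \<Rightarrow> real" and \<sigma> :: real
  assumes filt: "filtration (space M) F" and sub: "\<And>t. subalgebra M (F t)"
    and \<epsilon>: "\<And>t. t \<in> {1..T} \<Longrightarrow> \<epsilon> t \<in> borel_measurable (F t)"
    and indep: "\<And>t. t \<in> {1..T} \<Longrightarrow> indep_set (sets (F (t - 1))) (sets (vimage_algebra (space M) (\<epsilon> t) borel))"
    and subg: "\<And>t. t \<in> {1..T} \<Longrightarrow> subgaussian M \<sigma> (\<epsilon> t)"
begin

lemma space_F: "space (F t) = space M"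
  using sub[of t] by (simp add: subalgebra_def)

lemma sub_F: "s \<le> t \<Longrightarrow> subalgebra (F t) (F s)"
  using filtration.sets_F_mono[OF filt, of s t] by (simp add: subalgebra_def space_F)

lemma noise_measurable: "t \<in> {1..T} \<Longrightarrow> \<epsilon> t \<in> borel_measurable M"
  by (rule measurable_from_subalg[OF sub \<epsilon>])

lemma noise_zero: "\<sigma> = 0 \<Longrightarrow> AE \<omega> in M. \<forall>t\<in>{1..T}. \<epsilon> t \<omega> = 0"
  using subgaussian_zero_AE subg noise_measurable by (intro AE_finite_allI) auto

text \<open>Each factor has mean at most 1 once the past is frozen, so the exponential of the whole
  sum has mean at most 1; Markov's inequality at level 1/\<delta> gives the tail. Keeping
  \<open>h\<close> abstract serves the linear and the quadratic noise sums alike.\<close>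

lemma exponential_supermartingale_tail:
  fixes a :: "nat \<Rightarrow> 'a \<Rightarrow> real" and h :: "real \<Rightarrow> real \<Rightarrow> real"
  assumes a: "\<And>t. t \<in> {1..T} \<Longrightarrow> a t \<in> borel_measurable (F (t - 1))"
    and h [measurable]: "(\<lambda>p. h (fst p) (snd p)) \<in> borel_measurable (borel \<Otimes>\<^sub>M borel)"
    and le: "\<And>t \<omega>. t \<in> {1..T} \<Longrightarrow> \<omega> \<in> space M \<Longrightarrow> (\<integral>\<^sup>+\<omega>'. ennreal (exp (h (a t \<omega>) (\<epsilon> t \<omega>'))) \<partial>M) \<le> 1"
    and \<delta>: "0 < \<delta>"
  shows "1 - \<delta> \<le> prob {\<omega> \<in> space M. (\<Sum>t=1..T. h (a t \<omega>) (\<epsilon> t \<omega>)) \<le> ln (1 / \<delta>)}"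
proof -
  define S where "S n \<omega> = (\<Sum>t=1..n. h (a t \<omega>) (\<epsilon> t \<omega>))" for n \<omega>
  have S: "S n \<in> borel_measurable (F n)" if "n \<le> T" for n
    unfolding S_def[abs_def]
  proof (rule borel_measurable_sum)
    fix t assume t: "t \<in> {1..n}"
    have "a t \<in> borel_measurable (F n)" "\<epsilon> t \<in> borel_measurable (F n)"
      using measurable_from_subalg[OF sub_F a] measurable_from_subalg[OF sub_F \<epsilon>] t that by auto
    then have "(\<lambda>\<omega>. (a t \<omega>, \<epsilon> t \<omega>)) \<in> measurable (F n) (borel \<Otimes>\<^sub>M borel)" by measurable
    from measurable_compose[OF this h] show "(\<lambda>\<omega>. h (a t \<omega>) (\<epsilon> t \<omega>)) \<in> borel_measurable (F n)" by simp
  qed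
  have exp_S: "(\<integral>\<^sup>+\<omega>. ennreal (exp (S n \<omega>)) \<partial>M) \<le> 1" if "n \<le> T" for n
    using that
  proof (induction n)
    case 0
    then show ?case by (simp add: S_def emeasure_space_1)
  next
    case (Suc n)
    have n: "Suc n \<in> {1..T}" using Suc.prems by auto
    have [measurable]: "S n \<in> borel_measurable (F n)" using S Suc.prems by simp
    have "(\<integral>\<^sup>+\<omega>. ennreal (exp (S (Suc n) \<omega>)) \<partial>M)
        = (\<integral>\<^sup>+\<omega>. ennreal (exp (S n \<omega>)) * ennreal (exp (h (a (Suc n) \<omega>) (\<epsilon> (Suc n) \<omega>))) \<partial>M)"
      by (simp add: S_def exp_add ennreal_mult)
    also have "\<dots> \<le> (\<integral>\<^sup>+\<omega>. ennreal (exp (S n \<omega>)) \<partial>M)"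
    proof (rule nn_integral_indep_set_le[OF sub[of n],
          where Z = "\<lambda>\<omega>. ennreal (exp (S n \<omega>))" and a = "a (Suc n)" and Y = "\<epsilon> (Suc n)"
            and g = "\<lambda>u e. ennreal (exp (h u e))"])
      show "(\<lambda>\<omega>. ennreal (exp (S n \<omega>))) \<in> borel_measurable (F n)" by measurable
      show "a (Suc n) \<in> borel_measurable (F n)" using a[OF n] by simp
      show "\<epsilon> (Suc n) \<in> borel_measurable M" by (rule measurable_from_subalg[OF sub \<epsilon>[OF n]])
      show "indep_set (sets (F n)) (sets (vimage_algebra (space M) (\<epsilon> (Suc n)) borel))"
        using indep[OF n] by simp
      show "(\<lambda>p. ennreal (exp (h (fst p) (snd p)))) \<in> borel_measurable (borel \<Otimes>\<^sub>M borel)" by measurable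
    qed (rule le[OF n])
    finally show ?case using Suc by simp
  qed
  have [measurable]: "S T \<in> borel_measurable M"
    by (rule measurable_from_subalg[OF sub S]) simp
  have "emeasure M {\<omega> \<in> space M. 1 \<le> ennreal \<delta> * ennreal (exp (S T \<omega>))}
      \<le> ennreal \<delta> * (\<integral>\<^sup>+\<omega>. ennreal (exp (S T \<omega>)) * indicator (space M) \<omega> \<partial>M)"
    by (rule order_trans[OF _ nn_integral_Markov_inequality]) (auto intro!: emeasure_mono)
  also have "\<dots> \<le> ennreal \<delta> * 1"
  proof (rule mult_left_mono)
    have "(\<integral>\<^sup>+\<omega>. ennreal (exp (S T \<omega>)) * indicator (space M) \<omega> \<partial>M) = (\<integral>\<^sup>+\<omega>. ennreal (exp (S T \<omega>)) \<partial>M)"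
      by (intro nn_integral_cong) simp
    then show "(\<integral>\<^sup>+\<omega>. ennreal (exp (S T \<omega>)) * indicator (space M) \<omega> \<partial>M) \<le> 1"
      using exp_S[of T] by simp
  qed simp
  finally have le\<delta>: "emeasure M {\<omega> \<in> space M. 1 \<le> ennreal \<delta> * ennreal (exp (S T \<omega>))} \<le> ennreal \<delta>" by simp
  have "prob {\<omega> \<in> space M. \<not> S T \<omega> \<le> ln (1 / \<delta>)} \<le> prob {\<omega> \<in> space M. 1 \<le> ennreal \<delta> * ennreal (exp (S T \<omega>))}"
  proof (rule finite_measure_mono)
    show "{\<omega> \<in> space M. \<not> S T \<omega> \<le> ln (1 / \<delta>)} \<subseteq> {\<omega> \<in> space M. 1 \<le> ennreal \<delta> * ennreal (exp (S T \<omega>))}"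
    proof safe
      fix \<omega> assume "\<not> S T \<omega> \<le> ln (1 / \<delta>)"
      then have "exp (ln (1 / \<delta>)) < exp (S T \<omega>)" by simp
      then have "1 \<le> \<delta> * exp (S T \<omega>)" using \<delta> by (simp add: field_simps)
      then show "1 \<le> ennreal \<delta> * ennreal (exp (S T \<omega>))" using \<delta> by (simp add: ennreal_mult[symmetric])
    qed
  qed measurable
  also have "\<dots> \<le> \<delta>" using le\<delta> \<delta> by (simp add: emeasure_eq_measure)
  finally have "prob {\<omega> \<in> space M. \<not> S T \<omega> \<le> ln (1 / \<delta>)} \<le> \<delta>" .
  moreover have "prob {\<omega> \<in> space M. \<not> S T \<omega> \<le> ln (1 / \<delta>)}
      = 1 - prob {\<omega> \<in> space M. S T \<omega> \<le> ln (1 / \<delta>)}"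
    by (rule prob_neg) measurable
  ultimately show ?thesis by (simp add: S_def)
qed

lemma linear_noise_tail:
  assumes a: "\<And>t. t \<in> {1..T} \<Longrightarrow> a t \<in> borel_measurable (F (t - 1))"
    and c: "0 < c" and \<delta>: "0 < \<delta>"
  shows "1 - \<delta> \<le> prob {\<omega> \<in> space M. (\<Sum>t=1..T. a t \<omega> * \<epsilon> t \<omega>)
    \<le> c * (\<Sum>t=1..T. (a t \<omega>)\<^sup>2) + \<sigma>\<^sup>2 / (2 * c) * ln (1 / \<delta>)}"
    (is "_ \<le> prob ?E")
proof (cases "\<sigma> = 0")
  case True
  have [measurable]: "a t \<in> borel_measurable M" "\<epsilon> t \<in> borel_measurable M" if "t \<in> {1..T}" for t
    using measurable_from_subalg[OF sub a] noise_measurable that by auto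
  have ae: "AE \<omega> in M. (\<Sum>t=1..T. a t \<omega> * \<epsilon> t \<omega>) \<le> c * (\<Sum>t=1..T. (a t \<omega>)\<^sup>2) + \<sigma>\<^sup>2 / (2 * c) * ln (1 / \<delta>)"
    using noise_zero[OF True] by eventually_elim (use c True in \<open>simp add: sum_nonneg\<close>)
  have ev: "?E \<in> events" by measurable
  have "prob ?E = 1" by (rule iffD2[OF prob_Collect_eq_1[OF ev] ae])
  then show ?thesis using \<delta> by simp
next
  case False
  \<comment> \<open>The scale at which the sub-Gaussian exponent
    \<open>\<sigma>\<^sup>2 * (\<theta> * u)\<^sup>2 / 2\<close> exactly equals the compensator
    \<open>\<theta> * c * u\<^sup>2\<close>, whatever the size of \<open>u\<close>.\<close>
  define \<theta> where "\<theta> = 2 * c / \<sigma>\<^sup>2"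
  have \<theta>: "0 < \<theta>" using c False by (simp add: \<theta>_def)
  define h where "h u e = \<theta> * (u * e - c * u\<^sup>2)" for u e :: real
  have "1 - \<delta> \<le> prob {\<omega> \<in> space M. (\<Sum>t=1..T. h (a t \<omega>) (\<epsilon> t \<omega>)) \<le> ln (1 / \<delta>)}"
  proof (rule exponential_supermartingale_tail[where h = h, OF a _ _ \<delta>])
    show "(\<lambda>p. h (fst p) (snd p)) \<in> borel_measurable (borel \<Otimes>\<^sub>M borel)"
      unfolding h_def by measurable
    fix t \<omega> assume t: "t \<in> {1..T}"
    have [measurable]: "\<epsilon> t \<in> borel_measurable M" by (rule noise_measurable[OF t])
    define u where "u = a t \<omega>"
    have "(\<integral>\<^sup>+\<omega>'. ennreal (exp (h u (\<epsilon> t \<omega>'))) \<partial>M)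
        = (\<integral>\<^sup>+\<omega>'. ennreal (exp (- (\<theta> * c * u\<^sup>2))) * ennreal (exp ((\<theta> * u) * \<epsilon> t \<omega>')) \<partial>M)"
      by (intro nn_integral_cong) (simp add: h_def ennreal_mult[symmetric] exp_add[symmetric] algebra_simps)
    also have "\<dots> = ennreal (exp (- (\<theta> * c * u\<^sup>2))) * (\<integral>\<^sup>+\<omega>'. ennreal (exp ((\<theta> * u) * \<epsilon> t \<omega>')) \<partial>M)"
      by (rule nn_integral_cmult) measurable
    also have "\<dots> \<le> ennreal (exp (- (\<theta> * c * u\<^sup>2))) * ennreal (exp (\<sigma>\<^sup>2 * (\<theta> * u)\<^sup>2 / 2))"
      by (intro mult_left_mono subgaussian_nn_integral subg[OF t]) auto
    also have "\<dots> = 1"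
    proof -
      have "\<sigma>\<^sup>2 * (\<theta> * u)\<^sup>2 / 2 = \<theta> * c * u\<^sup>2"
        using False by (simp add: \<theta>_def power2_eq_square field_simps)
      then show ?thesis by (simp add: ennreal_mult[symmetric] exp_add[symmetric])
    qed
    finally show "(\<integral>\<^sup>+\<omega>'. ennreal (exp (h (a t \<omega>) (\<epsilon> t \<omega>'))) \<partial>M) \<le> 1" by (simp add: u_def)
  qed auto
  also have "{\<omega> \<in> space M. (\<Sum>t=1..T. h (a t \<omega>) (\<epsilon> t \<omega>)) \<le> ln (1 / \<delta>)} = ?E"
  proof -
    have "(\<Sum>t=1..T. h (a t \<omega>) (\<epsilon> t \<omega>)) = \<theta> * ((\<Sum>t=1..T. a t \<omega> * \<epsilon> t \<omega>) - c * (\<Sum>t=1..T. (a t \<omega>)\<^sup>2))" for \<omega>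
      unfolding h_def by (simp only: sum_distrib_left[symmetric] sum_subtractf)
    moreover have "\<theta> * X \<le> ln (1 / \<delta>) \<longleftrightarrow> X \<le> \<sigma>\<^sup>2 / (2 * c) * ln (1 / \<delta>)" for X
    proof -
      have "X \<le> ln (1 / \<delta>) / \<theta> \<longleftrightarrow> \<theta> * X \<le> ln (1 / \<delta>)"
        using \<theta> by (simp only: pos_le_divide_eq mult.commute)
      then show ?thesis by (simp add: \<theta>_def mult.commute)
    qed
    ultimately show ?thesis by (simp add: diff_le_eq add.commute)
  qed
  finally show ?thesis .
qed

lemma quadratic_noise_tail:
  assumes v: "\<And>t. t \<in> {1..T} \<Longrightarrow> v t \<in> borel_measurable (F (t - 1))"
    and bd: "\<And>t \<omega>. t \<in> {1..T} \<Longrightarrow> \<omega> \<in> space M \<Longrightarrow> 0 \<le> v t \<omega> \<and> v t \<omega> \<le> b"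
    and b: "0 < b" and \<delta>: "0 < \<delta>"
  shows "1 - \<delta> \<le> prob {\<omega> \<in> space M. (\<Sum>t=1..T. (\<epsilon> t \<omega>)\<^sup>2 * v t \<omega>)
    \<le> 2 * \<sigma>\<^sup>2 * (\<Sum>t=1..T. v t \<omega>) + 4 * \<sigma>\<^sup>2 * b * ln (1 / \<delta>)}"
    (is "_ \<le> prob ?E")
proof (cases "\<sigma> = 0")
  case True
  have [measurable]: "v t \<in> borel_measurable M" "\<epsilon> t \<in> borel_measurable M" if "t \<in> {1..T}" for t
    using measurable_from_subalg[OF sub v] noise_measurable that by auto
  have ae: "AE \<omega> in M. (\<Sum>t=1..T. (\<epsilon> t \<omega>)\<^sup>2 * v t \<omega>)
      \<le> 2 * \<sigma>\<^sup>2 * (\<Sum>t=1..T. v t \<omega>) + 4 * \<sigma>\<^sup>2 * b * ln (1 / \<delta>)"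
    using noise_zero[OF True] by eventually_elim (use True in simp)
  have ev: "?E \<in> events" by measurable
  have "prob ?E = 1" by (rule iffD2[OF prob_Collect_eq_1[OF ev] ae])
  then show ?thesis using \<delta> by simp
next
  case False
  \<comment> \<open>The largest scale for which \<open>subgaussian_square\<close> applies to every
    coefficient \<open>s * u\<close> with \<open>u \<le> b\<close>.\<close>
  define s where "s = 1 / (4 * \<sigma>\<^sup>2 * b)"
  have s: "0 < s" using b False by (simp add: s_def)
  define h where "h u e = s * (e\<^sup>2 * u - 2 * \<sigma>\<^sup>2 * u)" for u e :: real
  have "1 - \<delta> \<le> prob {\<omega> \<in> space M. (\<Sum>t=1..T. h (v t \<omega>) (\<epsilon> t \<omega>)) \<le> ln (1 / \<delta>)}"
  proof (rule exponential_supermartingale_tail[where h = h, OF v _ _ \<delta>])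
    show "(\<lambda>p. h (fst p) (snd p)) \<in> borel_measurable (borel \<Otimes>\<^sub>M borel)"
      unfolding h_def by measurable
    fix t \<omega> assume t: "t \<in> {1..T}" and \<omega>: "\<omega> \<in> space M"
    have [measurable]: "\<epsilon> t \<in> borel_measurable M" by (rule noise_measurable[OF t])
    define u where "u = v t \<omega>"
    have u: "0 \<le> u" "u \<le> b" using bd[OF t \<omega>] by (auto simp: u_def)
    have "(\<integral>\<^sup>+\<omega>'. ennreal (exp (h u (\<epsilon> t \<omega>'))) \<partial>M)
        = (\<integral>\<^sup>+\<omega>'. ennreal (exp (- (2 * (s * u) * \<sigma>\<^sup>2))) * ennreal (exp ((s * u) * (\<epsilon> t \<omega>')\<^sup>2)) \<partial>M)"
      by (intro nn_integral_cong) (simp add: h_def ennreal_mult[symmetric] exp_add[symmetric] algebra_simps)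
    also have "\<dots> = ennreal (exp (- (2 * (s * u) * \<sigma>\<^sup>2))) * (\<integral>\<^sup>+\<omega>'. ennreal (exp ((s * u) * (\<epsilon> t \<omega>')\<^sup>2)) \<partial>M)"
      by (rule nn_integral_cmult) measurable
    also have "\<dots> \<le> ennreal (exp (- (2 * (s * u) * \<sigma>\<^sup>2))) * ennreal (exp (2 * (s * u) * \<sigma>\<^sup>2))"
    proof (intro mult_left_mono subgaussian_square subg[OF t] noise_measurable[OF t])
      show "0 \<le> s * u" using s u by simp
      show "2 * (s * u) * \<sigma>\<^sup>2 \<le> 1 / 2" using u b False by (simp add: s_def field_simps)
    qed simp
    also have "\<dots> = 1" by (simp add: ennreal_mult[symmetric] exp_add[symmetric])
    finally show "(\<integral>\<^sup>+\<omega>'. ennreal (exp (h (v t \<omega>) (\<epsilon> t \<omega>'))) \<partial>M) \<le> 1" by (simp add: u_def)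
  qed auto
  also have "{\<omega> \<in> space M. (\<Sum>t=1..T. h (v t \<omega>) (\<epsilon> t \<omega>)) \<le> ln (1 / \<delta>)} = ?E"
  proof -
    have "(\<Sum>t=1..T. h (v t \<omega>) (\<epsilon> t \<omega>))
        = s * ((\<Sum>t=1..T. (\<epsilon> t \<omega>)\<^sup>2 * v t \<omega>) - 2 * \<sigma>\<^sup>2 * (\<Sum>t=1..T. v t \<omega>))" for \<omega>
      unfolding h_def by (simp only: sum_distrib_left[symmetric] sum_subtractf)
    moreover have "s * X \<le> ln (1 / \<delta>) \<longleftrightarrow> X \<le> 4 * \<sigma>\<^sup>2 * b * ln (1 / \<delta>)" for X
    proof -
      have "X \<le> ln (1 / \<delta>) / s \<longleftrightarrow> s * X \<le> ln (1 / \<delta>)"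
        using s by (simp only: pos_le_divide_eq mult.commute)
      then show ?thesis by (simp add: s_def mult.commute)
    qed
    ultimately show ?thesis by (simp add: diff_le_eq add.commute)
  qed
  finally show ?thesis .
qed

end

lemma (in prob_space) prob_Int_ge:
  assumes "1 - \<delta> \<le> prob X" "1 - \<delta> \<le> prob Y" and "\<delta> < 1"
  shows "1 - 2 * \<delta> \<le> prob (X \<inter> Y)"
proof -
  \<comment> \<open>A set that is not an event has measure 0 by convention, which is below
    \<open>1 - \<delta>\<close> because \<open>\<delta> < 1\<close>.\<close>
  have ev: "X \<in> events" "Y \<in> events"
    using assms measure_notin_sets by fastforce+
  then have "prob (X \<union> Y) = prob X + prob Y - prob (X \<inter> Y)"
    using measure_Un3[of X M Y] by (simp add: fmeasurable_eq_sets)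
  then show "1 - 2 * \<delta> \<le> prob (X \<inter> Y)" using assms prob_le_1[of "X \<union> Y"] by linarith
qed

section \<open>The regret bound\<close>

theorem theorem4p1:
  fixes M :: "'w measure" and F :: "nat \<Rightarrow> 'w measure"
    and x :: "nat \<Rightarrow> 'w \<Rightarrow> real ^ 'd" and \<epsilon> :: "nat \<Rightarrow> 'w \<Rightarrow> real"
    and \<mu>h :: "nat \<Rightarrow> 'w \<Rightarrow> real ^ 'd" and \<mu>s :: "real ^ 'd"
    and \<phi> :: "real \<Rightarrow> real" and I :: "real set"
    and A B \<kappa> K \<sigma> lam \<delta> :: real and T :: nat
  defines "y \<equiv> (\<lambda>\<omega>. glr_label \<phi> \<mu>s (\<lambda>t. x t \<omega>) (\<lambda>t. \<epsilon> t \<omega>))"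
  assumes "prob_space M"
    and "activation \<phi> I B \<kappa> K"
    and "norm \<mu>s \<le> B"
    and "\<And>t \<omega>. t \<in> {1..T} \<Longrightarrow> \<omega> \<in> space M \<Longrightarrow> norm (x t \<omega>) \<le> A"
    and "online_protocol M F T x \<epsilon>"
    and "iid_noise M T \<epsilon>"
    and "\<And>t. t \<in> {1..T} \<Longrightarrow> (\<integral>\<omega>. \<epsilon> t \<omega> \<partial>M) = 0"
    and "\<And>t. t \<in> {1..T} \<Longrightarrow> subgaussian M \<sigma> (\<epsilon> t)"
    and "lam = 4 * A\<^sup>2 * K\<^sup>2 / \<kappa>" and "0 < lam"
    and "\<And>\<omega>. \<omega> \<in> space M \<Longrightarrow> ftrl_iterates lam \<phi> (\<lambda>t. x t \<omega>) (y \<omega>) T (\<lambda>t. \<mu>h t \<omega>)"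
    and "\<And>\<omega>. \<omega> \<in> space M \<Longrightarrow> args_within I (\<lambda>t. x t \<omega>) \<mu>s (\<lambda>t. \<mu>h t \<omega>) T"
    and "0 < \<delta>" and "\<delta> < 1 / 2"
  shows "measure M {\<omega> \<in> space M.
           stoc_regret \<phi> (\<lambda>t. x t \<omega>) (y \<omega>) \<mu>s (\<lambda>t. \<mu>h t \<omega>) T
             \<le> 34 / \<kappa> * \<sigma>\<^sup>2 * real CARD('d)
                   * ln ((4 * real CARD('d) * K\<^sup>2 + real T * \<kappa>\<^sup>2) / (4 * real CARD('d) * K\<^sup>2))
               + 8 * K\<^sup>2 * A\<^sup>2 * B\<^sup>2 / \<kappa>
               + 2 * (2 / \<kappa> + 3 * \<kappa> / K\<^sup>2) * \<sigma>\<^sup>2 * ln (1 / \<delta>)}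
         \<ge> 1 - 2 * \<delta>"
proof -
  interpret prob_space M by (rule assms(2))
  interpret noise: noise_process M F T \<epsilon> \<sigma>
    using assms(6,9) unfolding online_protocol_def
    by (intro noise_process.intro noise_process_axioms.intro assms(2)) blast+
  have path: "ftrl_path \<phi> I B \<kappa> K A lam (\<lambda>t. x t \<omega>) (\<lambda>t. \<epsilon> t \<omega>) T \<mu>s (\<lambda>t. \<mu>h t \<omega>)"
    if "\<omega> \<in> space M" for \<omega>
    using assms(3,4,10,11) assms(5)[OF _ that] assms(12,13)[OF that] unfolding y_def
    by (intro ftrl_path.intro)
  \<comment> \<open>A sample outcome, used only to extract facts that do not depend on it, such as
    \<open>0 \<in> I\<close> and \<open>0 < K\<close>.\<close>
  obtain \<omega>0 where "\<omega>0 \<in> space M" using not_empty by blast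
  interpret base: ftrl_path \<phi> I B \<kappa> K A lam "\<lambda>t. x t \<omega>0" "\<lambda>t. \<epsilon> t \<omega>0" T \<mu>s "\<lambda>t. \<mu>h t \<omega>0"
    by (rule path) fact
  define gap where "gap t \<omega> = x t \<omega> \<bullet> (\<mu>h t \<omega> - \<mu>s)" for t \<omega>
  define w where "w t \<omega> = width (2 * lam) \<kappa> (\<lambda>\<tau>. x \<tau> \<omega>) t" for t \<omega>
  define L where "L = ln (1 / \<delta>)"
  have L: "0 \<le> L" unfolding L_def using assms(14,15) by simp
  have I: "is_interval I" and \<phi>: "continuous_on I \<phi>"
    using assms(3) by (rule activation_interval, rule activation_continuous)
  \<comment> \<open>The shift \<open>\<tau> - 1 \<le> t\<close> makes the feature of a round
    available before its noise; \<open>gap t\<close> and \<open>w t\<close> are predictable because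
    of it.\<close>
  have x: "x \<tau> \<in> borel_measurable (F t)" if "\<tau> \<in> {1..T}" "\<tau> - 1 \<le> t" for \<tau> t
    using assms(6) that measurable_from_subalg[OF noise.sub_F[of "\<tau> - 1" t]]
    unfolding online_protocol_def by blast
  have true_in: "x t \<omega> \<bullet> \<mu>s \<in> I" if "t \<in> {1..T}" "\<omega> \<in> space M" for t \<omega>
    by (rule ftrl_path.true_in[OF path]) fact+
  have iterate_in: "x \<tau> \<omega> \<bullet> \<mu>h t \<omega> \<in> I" if "t \<in> {1..T}" "\<tau> \<in> {1..t}" "\<omega> \<in> space M" for t \<tau> \<omega>
    by (rule ftrl_path.iterate_in[OF path]) fact+
  have label: "(\<lambda>\<omega>. y \<omega> \<tau>) \<in> borel_measurable (F t)" if \<tau>: "\<tau> \<in> {1..T}" "\<tau> \<le> t" for \<tau> t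
  proof -
    have [measurable]: "x \<tau> \<in> borel_measurable (F t)" using x \<tau> by simp
    have [measurable]: "\<epsilon> \<tau> \<in> borel_measurable (F t)"
      by (rule measurable_from_subalg[OF noise.sub_F[OF \<tau>(2)] noise.\<epsilon>[OF \<tau>(1)]])
    have [measurable]: "(\<lambda>\<omega>. \<phi> (x \<tau> \<omega> \<bullet> \<mu>s)) \<in> borel_measurable (F t)"
      using true_in[OF \<tau>(1)] by (intro measurable_compose_interval[OF I \<phi>]) (auto simp: noise.space_F)
    show ?thesis unfolding y_def glr_label_def inner_commute[of \<mu>s] by measurable
  qed
  have \<mu>h: "\<mu>h t \<in> borel_measurable (F (t - 1))" if t: "t \<in> {1..T}" for t
  proof (rule ftrl_minimizer_measurable[OF assms(3) base.zero_in assms(11)])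
    show "x \<tau> \<in> borel_measurable (F (t - 1))" if "\<tau> \<in> {1..t - 1}" for \<tau> using that t by (intro x) auto
    show "(\<lambda>\<omega>. y \<omega> \<tau>) \<in> borel_measurable (F (t - 1))" if "\<tau> \<in> {1..t - 1}" for \<tau>
      using that t by (intro label) auto
    show "ftrl_obj lam \<phi> (\<lambda>\<tau>. x \<tau> \<omega>) (y \<omega>) (t - 1) (\<mu>h t \<omega>)
        \<le> ftrl_obj lam \<phi> (\<lambda>\<tau>. x \<tau> \<omega>) (y \<omega>) (t - 1) \<nu>" if "\<omega> \<in> space (F (t - 1))" for \<omega> \<nu>
      using that assms(11) t by (intro ftrl_iterates_minimal[OF assms(12)]) (auto simp: noise.space_F)
    show "x \<tau> \<omega> \<bullet> \<mu>h t \<omega> \<in> I" if "\<omega> \<in> space (F (t - 1))" "\<tau> \<in> {1..t - 1}" for \<omega> \<tau>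
      using that t by (intro iterate_in) (auto simp: noise.space_F)
  qed
  have gap_meas: "gap t \<in> borel_measurable (F (t - 1))" if t: "t \<in> {1..T}" for t
  proof -
    have [measurable]: "\<mu>h t \<in> borel_measurable (F (t - 1))" "x t \<in> borel_measurable (F (t - 1))"
      using \<mu>h[OF t] x[OF t] by auto
    show ?thesis unfolding gap_def[abs_def] by measurable
  qed
  have w_meas: "w t \<in> borel_measurable (F (t - 1))" if "t \<in> {1..T}" for t
    unfolding w_def[abs_def] using that by (intro measurable_width x) auto
  define regret where "regret \<omega> = stoc_regret \<phi> (\<lambda>t. x t \<omega>) (y \<omega>) \<mu>s (\<lambda>t. \<mu>h t \<omega>) T" for \<omega>
  \<comment> \<open>Needed so that the final set is an event; otherwise monotonicity of the measure
    would not apply to it.\<close>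
  have [measurable]: "regret \<in> borel_measurable M"
  proof -
    let ?a = "antideriv \<phi>"
    have a: "continuous_on I ?a"
      by (rule continuous_on_antideriv_interval[OF I base.zero_in \<phi>])
    have "(\<lambda>\<omega>. ?a (x t \<omega> \<bullet> \<mu>h t \<omega>) - ?a (x t \<omega> \<bullet> \<mu>s) - \<phi> (x t \<omega> \<bullet> \<mu>s) * gap t \<omega> - gap t \<omega> * \<epsilon> t \<omega>)
        \<in> borel_measurable M" if t: "t \<in> {1..T}" for t
    proof -
      have [measurable]: "x t \<in> borel_measurable M" "\<mu>h t \<in> borel_measurable M"
        "gap t \<in> borel_measurable M" "\<epsilon> t \<in> borel_measurable M"
        using measurable_from_subalg[OF noise.sub x[OF t order_refl]] measurable_from_subalg[OF noise.sub \<mu>h[OF t]]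
          measurable_from_subalg[OF noise.sub gap_meas[OF t]] noise.noise_measurable[OF t] by auto
      have true_meas: "(\<lambda>\<omega>. f (x t \<omega> \<bullet> \<mu>s)) \<in> borel_measurable M" if "continuous_on I f" for f :: "real \<Rightarrow> real"
      proof (rule measurable_compose_interval[OF I that])
        show "(\<lambda>\<omega>. x t \<omega> \<bullet> \<mu>s) \<in> borel_measurable M" by measurable
      qed (rule true_in[OF t])
      have iterate_meas: "(\<lambda>\<omega>. ?a (x t \<omega> \<bullet> \<mu>h t \<omega>)) \<in> borel_measurable M"
      proof (rule measurable_compose_interval[OF I a])
        show "(\<lambda>\<omega>. x t \<omega> \<bullet> \<mu>h t \<omega>) \<in> borel_measurable M" by measurable
      qed (use t in \<open>auto intro: iterate_in\<close>)
      note [measurable] = true_meas[OF \<phi>] true_meas[OF a] iterate_meas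
      show ?thesis by measurable
    qed
    then have "(\<lambda>\<omega>. \<Sum>t=1..T. ?a (x t \<omega> \<bullet> \<mu>h t \<omega>) - ?a (x t \<omega> \<bullet> \<mu>s) - \<phi> (x t \<omega> \<bullet> \<mu>s) * gap t \<omega>
        - gap t \<omega> * \<epsilon> t \<omega>) \<in> borel_measurable M"
      by (rule borel_measurable_sum)
    moreover have "regret \<omega> = (\<Sum>t=1..T. ?a (x t \<omega> \<bullet> \<mu>h t \<omega>) - ?a (x t \<omega> \<bullet> \<mu>s)
        - \<phi> (x t \<omega> \<bullet> \<mu>s) * gap t \<omega> - gap t \<omega> * \<epsilon> t \<omega>)" if "\<omega> \<in> space M" for \<omega>
      unfolding regret_def y_def gap_def by (rule ftrl_path.regret_eq[OF path[OF that]])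
    ultimately show ?thesis by (subst measurable_cong) auto
  qed
  define bound where "bound = 34 / \<kappa> * \<sigma>\<^sup>2 * real CARD('d)
      * ln ((4 * real CARD('d) * K\<^sup>2 + real T * \<kappa>\<^sup>2) / (4 * real CARD('d) * K\<^sup>2))
      + 8 * K\<^sup>2 * A\<^sup>2 * B\<^sup>2 / \<kappa> + 2 * (2 / \<kappa> + 3 * \<kappa> / K\<^sup>2) * \<sigma>\<^sup>2 * L"
  define E1 where "E1 = {\<omega> \<in> space M. (\<Sum>t=1..T. gap t \<omega> * \<epsilon> t \<omega>)
    \<le> \<kappa> / 8 * (\<Sum>t=1..T. (gap t \<omega>)\<^sup>2) + \<sigma>\<^sup>2 / (2 * (\<kappa> / 8)) * L}"
  define E2 where "E2 = {\<omega> \<in> space M. (\<Sum>t=1..T. (\<epsilon> t \<omega>)\<^sup>2 * w t \<omega>)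
    \<le> 2 * \<sigma>\<^sup>2 * (\<Sum>t=1..T. w t \<omega>) + 4 * \<sigma>\<^sup>2 * (\<kappa> / (8 * K\<^sup>2)) * L}"
  have "1 - \<delta> \<le> prob E1"
    unfolding E1_def L_def using base.kappa_pos assms(14) gap_meas by (intro noise.linear_noise_tail) auto
  moreover have "1 - \<delta> \<le> prob E2"
    unfolding E2_def L_def
  proof (rule noise.quadratic_noise_tail[OF w_meas _ _ assms(14)])
    show "0 < \<kappa> / (8 * K\<^sup>2)" using base.kappa_pos base.K_pos by simp
    show "0 \<le> w t \<omega> \<and> w t \<omega> \<le> \<kappa> / (8 * K\<^sup>2)" if "t \<in> {1..T}" "\<omega> \<in> space M" for t \<omega>
      unfolding w_def using that ftrl_path.w_nonneg[OF path] ftrl_path.w_le[OF path] by auto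
  qed
  ultimately have "1 - 2 * \<delta> \<le> prob (E1 \<inter> E2)"
    using assms(15) by (intro prob_Int_ge) auto
  also have "\<dots> \<le> prob {\<omega> \<in> space M. regret \<omega> \<le> bound}"
  proof (rule finite_measure_mono)
    show "E1 \<inter> E2 \<subseteq> {\<omega> \<in> space M. regret \<omega> \<le> bound}"
    proof
      fix \<omega> assume \<omega>: "\<omega> \<in> E1 \<inter> E2"
      then have sp: "\<omega> \<in> space M" by (simp add: E1_def)
      have "regret \<omega> \<le> bound"
        unfolding regret_def y_def bound_def
        using \<omega> by (intro ftrl_path.regret_explicit_bound[OF path[OF sp] L]) (simp_all add: E1_def E2_def gap_def w_def)
      then show "\<omega> \<in> {\<omega> \<in> space M. regret \<omega> \<le> bound}" using sp by simp
    qed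
  qed measurable
  finally show ?thesis unfolding regret_def bound_def L_def .
qed

end
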